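(* Let $\mathcal{K}$ be the symmetric cone (cone of squares) of a Euclidean Jordan algebra $\mathcal{E}$, $\mathcal{L}\subseteq\mathcal{E}$ a subspace and $a\in\mathcal{E}$ such that $\mathcal{K}\cap(\mathcal{L}+a)\ne\emptyset$. Then there is a positive constant $\kappa$ (depending on $\mathcal{K},\mathcal{L},a$) such that whenever $x\in\mathcal{E}$ and $\epsilon$ satisfy $$\operatorname{dist}(x,\mathcal{K})\le\epsilon,\qquad\operatorname{dist}(x,\mathcal{L}+a)\le\epsilon,$$ we have $$\operatorname{dist}\bigl(x,(\mathcal{L}+a)\cap\mathcal{K}\bigr)\le(\kappa\|x\|+\kappa)\left(\sum_{j=0}^{d_{\mathrm{PPS}}(\mathcal{L},a)}\epsilon^{(2^{-j})}\|x\|^{1-2^{-j}}\right).$$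
   Context: A Euclidean Jordan algebra is a finite-dimensional real vector space $\mathcal{E}$ with a bilinear product $\circ$ (with identity element $e$) and an inner product such that $x\circ y=y\circ x$, $x\circ(x^2\circ y)=x^2\circ(x\circ y)$ with $x^2=x\circ x$, and $\langle x\circ y,z\rangle=\langle x,y\circ z\rangle$. Its cone of squares is $\mathcal{K}=\{x^2: x\in\mathcal{E}\}$, a symmetric cone. By the spectral theorem every $x$ is $\sum_{i=1}^r\lambda_ic_i$ with $c_i$ primitive idempotents, $c_i\circ c_j=0$ for $i\ne j$, $\sum c_i=e$, and unique real eigenvalues $\lambda_i$; $\operatorname{tr}x=\sum_i\lambda_i$. Throughout, the inner product is $\langle x,y\rangle=\operatorname{tr}(x\circ y)$, with induced norm $\|x\|=\sqrt{\operatorname{tr}(x^2)}$, and $\operatorname{dist}(x,C)=\inf\{\|x-y\|:y\in C\}$. The $j=0$ term of the sum is $\epsilon$. $C^*=\{x:\langle x,y\rangle\ge0\ \forall y\in C\}$, $C^\perp$ is the orthogonal complement, $\operatorname{ri}$ the relative interior. PPS (partial polyhedral Slater) condition: for a closed convex cone $\mathcal{C}\subseteq\mathcal{E}$, $(\mathcal{C},\mathcal{L},a)$ satisfies the PPS condition if $\mathcal{E}$ can be written as an orthogonal product $\mathcal{E}=\mathcal{E}^1\times\mathcal{E}^2$ (a factor may be $\{0\}$) with $\mathcal{C}=\mathcal{C}^1\times\mathcal{C}^2$, where $\mathcal{C}^i\subseteq\mathcal{E}^i$ are closed convex cones, $\mathcal{C}^2$ is polyhedral, and there is $(x_1,x_2)\in\mathcal{L}+a$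 with $x_1\in\operatorname{ri}\mathcal{C}^1$, $x_2\in\mathcal{C}^2$. (So it holds if $(\operatorname{ri}\mathcal{C})\cap(\mathcal{L}+a)\ne\emptyset$, or if $\mathcal{C}$ is polyhedral and $\mathcal{C}\cap(\mathcal{L}+a)\neq\emptyset$.) $d_{\mathrm{PPS}}(\mathcal{L},a)$ is the minimum $k\ge0$ for which there are $\mathcal{F}_1=\mathcal{K}$, $z_i\in\mathcal{F}_i^*\cap\mathcal{L}^\perp\cap\{a\}^\perp$, $\mathcal{F}_{i+1}=\mathcal{F}_i\cap\{z_i\}^\perp$ ($i=1,\dots,k$) with $(\mathcal{F}_{k+1},\mathcal{L},a)$ satisfying the PPS condition; it is finite when $\mathcal{K}\cap(\mathcal{L}+a)\ne\emptyset$. *)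

theory Defs
  imports "HOL-Analysis.Analysis"
begin

locale euclidean_jordan_algebra =
  fixes jp :: "'a::euclidean_space \<Rightarrow> 'a \<Rightarrow> 'a" and e :: 'a
  assumes jp_bilinear: "bilinear jp"
    and jp_unit: "jp e x = x"
    and jp_commute: "jp x y = jp y x"
    and jp_jordan: "jp x (jp (jp x x) y) = jp (jp x x) (jp x y)"
    and jp_inner: "jp x y \<bullet> z = x \<bullet> jp y z"

definition cone_of_squares :: "('a \<Rightarrow> 'a \<Rightarrow> 'a) \<Rightarrow> 'a set" where
  "cone_of_squares jp = range (\<lambda>x. jp x x)"

definition idempotent :: "('a \<Rightarrow> 'a \<Rightarrow> 'a) \<Rightarrow> 'a \<Rightarrow> bool" where
  "idempotent jp c \<longleftrightarrow> jp c c = c"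

definition primitive_idempotent :: "('a::real_vector \<Rightarrow> 'a \<Rightarrow> 'a) \<Rightarrow> 'a \<Rightarrow> bool" where
  "primitive_idempotent jp c \<longleftrightarrow> idempotent jp c \<and> c \<noteq> 0 \<and>
     \<not> (\<exists>u v. idempotent jp u \<and> idempotent jp v \<and> u \<noteq> 0 \<and> v \<noteq> 0 \<and> c = u + v)"

(* A set loses no multiplicities: orthogonal nonzero idempotents are distinct. *)
definition jordan_frame :: "('a::real_vector \<Rightarrow> 'a \<Rightarrow> 'a) \<Rightarrow> 'a \<Rightarrow> 'a set \<Rightarrow> bool" where
  "jordan_frame jp e C \<longleftrightarrow> finite C \<and> (\<forall>c\<in>C. primitive_idempotent jp c) \<and>
     (\<forall>c\<in>C. \<forall>d\<in>C. c \<noteq> d \<longrightarrow> jp c d = 0) \<and> \<Sum>C = e"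

(* Well defined by the spectral theorem: every x has a decomposition
   x = (\<Sum>c\<in>C. l c *\<^sub>R c) over a Jordan frame C, and the family of
   eigenvalues l c, counted with multiplicity, is determined by x. *)
definition jordan_trace :: "('a::real_vector \<Rightarrow> 'a \<Rightarrow> 'a) \<Rightarrow> 'a \<Rightarrow> 'a \<Rightarrow> real" where
  "jordan_trace jp e x =
     (THE t. \<exists>C l. jordan_frame jp e C \<and> x = (\<Sum>c\<in>C. l c *\<^sub>R c) \<and> t = (\<Sum>c\<in>C. l c))"

definition dual_cone :: "'a::real_inner set \<Rightarrow> 'a set" where
  "dual_cone C = {x. \<forall>y\<in>C. x \<bullet> y \<ge> 0}"

definition affine_translate :: "'a::plus set \<Rightarrow> 'a \<Rightarrow> 'a set" where
  "affine_translate L a = (\<lambda>l. l + a) ` L"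

(* The orthogonal product of the factors E1 and E2 is an internal one: E2 is the
   orthogonal complement of E1, and C1 \<times> C2 is the Minkowski sum C1 + C2. *)
definition PPS :: "'a::euclidean_space set \<Rightarrow> 'a set \<Rightarrow> 'a \<Rightarrow> bool" where
  "PPS C L a \<longleftrightarrow>
     (\<exists>E1 E2 C1 C2. subspace E1 \<and> E2 = E1\<^sup>\<bottom> \<and> C1 \<subseteq> E1 \<and> C2 \<subseteq> E2 \<and>
        closed C1 \<and> convex_cone C1 \<and> closed C2 \<and> convex_cone C2 \<and> polyhedron C2 \<and>
        C = C1 + C2 \<and>
        (\<exists>x1\<in>rel_interior C1. \<exists>x2\<in>C2. x1 + x2 \<in> affine_translate L a))"

definition d_PPS :: "'a::euclidean_space set \<Rightarrow> 'a set \<Rightarrow> 'a \<Rightarrow> nat" where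
  "d_PPS K L a =
     (LEAST k. \<exists>(F :: nat \<Rightarrow> 'a set) z. F 1 = K \<and>
        (\<forall>i\<in>{1..k}. z i \<in> dual_cone (F i) \<inter> L\<^sup>\<bottom> \<inter> {a}\<^sup>\<bottom> \<and> F (i + 1) = F i \<inter> {z i}\<^sup>\<bottom>) \<and>
        PPS (F (k + 1)) L a)"

end

theory Submission
  imports Defs
begin

text \<open>Let \<open>F = {w \<circ> w | w \<in> W}\<close> be the cone of squares of a subalgebra \<open>W\<close>; by the spectral
  theorem it is self-dual in \<open>W\<close>. A vector \<open>z\<close> of its dual cone, projected to \<open>W\<close>, is on \<open>F\<close>
  comparable to an idempotent \<open>c\<close>. For \<open>y \<in> F\<close>, pairing \<open>y\<close> with the square of \<open>c - s (c \<circ> y)\<close> and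
  optimising \<open>s\<close> bounds the squared norm of \<open>c \<circ> y\<close> by a multiple of \<open>\<parallel>y\<parallel> \<langle>y, c\<rangle>\<close>. Hence \<open>y\<close> is within
  a multiple of \<open>sqrt (\<parallel>y\<parallel> \<langle>y, z\<rangle>)\<close> of its component in the Peirce space \<open>{w \<in> W. c \<circ> w = 0}\<close>, which
  by self-duality lies in the cone of squares of that space, and this cone is the face
  \<open>F \<inter> {z}\<^sup>\<bottom>\<close>. So every facial reduction step costs one square root, and the PPS condition at
  the end of the chain gives a Lipschitz bound through Hoffman's lemma.\<close>

section \<open>Symmetric operators\<close>

text \<open>A maximiser \<open>w\<close> of the Rayleigh quotient on the unit sphere of
  \<open>A\<close> is an eigenvector. Instead of differentiating, \<open>w\<close> is perturbed
  along its residual \<open>y = m *\<^sub>R w - T w\<close>, and maximality forces this residual to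
  vanish.\<close>

lemma symmetric_eigenvector:
  fixes T :: "'a::euclidean_space \<Rightarrow> 'a"
  assumes lin: "linear T" and sub: "subspace A" and inv: "\<And>x. x \<in> A \<Longrightarrow> T x \<in> A"
    and sym: "\<And>x y. T x \<bullet> y = x \<bullet> T y" and ne: "v \<in> A" "v \<noteq> 0"
  obtains w \<mu> where "w \<in> A" "w \<noteq> 0" "T w = \<mu> *\<^sub>R w"
proof -
  interpret T: linear T by fact
  let ?S = "A \<inter> sphere 0 1"
  have cmp: "compact ?S"
    using closed_subspace[OF sub] by (simp add: closed_Int_compact)
  have "v /\<^sub>R norm v \<in> ?S"
    using ne sub by (simp add: subspace_scale)
  then have "?S \<noteq> {}" by blast
  moreover have "continuous_on ?S (\<lambda>x. T x \<bullet> x)"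
    using linear_continuous_on[OF linear_conv_bounded_linear[THEN iffD1, OF lin]]
    by (intro continuous_intros)
  ultimately obtain w where w: "w \<in> ?S" and max: "\<And>x. x \<in> ?S \<Longrightarrow> T x \<bullet> x \<le> T w \<bullet> w"
    using continuous_attains_sup[OF cmp, of "\<lambda>x. T x \<bullet> x"] by blast
  define m where "m = T w \<bullet> w"
  have ww: "w \<bullet> w = 1" using w by (simp add: dot_square_norm)
  have q: "T x \<bullet> x \<le> m * (x \<bullet> x)" if "x \<in> A" for x
  proof (cases "x = 0")
    case False
    then have "x /\<^sub>R norm x \<in> ?S"
      using subspace_scale[OF sub that, of "inverse (norm x)"] by simp
    then have "T (x /\<^sub>R norm x) \<bullet> (x /\<^sub>R norm x) \<le> m"
      unfolding m_def by (rule max)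
    then have "(T x \<bullet> x) / (norm x)\<^sup>2 \<le> m"
      by (simp add: T.scale power2_eq_square divide_inverse mult_ac)
    then show ?thesis using False
      by (simp add: pos_divide_le_eq dot_square_norm)
  qed (simp add: T.zero)
  define y where "y = m *\<^sub>R w - T w"
  have yA: "y \<in> A"
    unfolding y_def using w sub inv by (auto intro: subspace_diff subspace_scale)
  define n where "n = y \<bullet> y"
  define b where "b = m * (y \<bullet> y) - T y \<bullet> y"
  have b0: "b \<ge> 0" using q[OF yA] by (simp add: b_def)
  have "0 \<le> 2 * t * n + t\<^sup>2 * b" for t
  proof -
    have "w + t *\<^sub>R y \<in> A"
      using w yA sub by (auto intro: subspace_add subspace_scale)
    from q[OF this] have "0 \<le> m * (w \<bullet> w) - m + 2 * t * (m * (w \<bullet> y) - T w \<bullet> y) + t\<^sup>2 * b"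
      by (simp add: T.add T.scale inner_simps sym[of y w] m_def b_def inner_commute[of y w]
          inner_commute[of y "T w"] algebra_simps power2_eq_square)
    moreover have "n = m * (w \<bullet> y) - T w \<bullet> y"
      using arg_cong[OF y_def, of "\<lambda>v. v \<bullet> y"] by (simp add: n_def inner_simps)
    ultimately show ?thesis using ww by simp
  qed
  \<comment> \<open>This choice makes the negative linear term outweigh the quadratic one; the added
    1 covers \<open>b = 0\<close>.\<close>
  from this[of "- n / (b + 1)"] have "0 \<le> - 2 * n\<^sup>2 / (b + 1) + n\<^sup>2 * b / (b + 1)\<^sup>2"
    by (simp add: power2_eq_square)
  moreover have "n\<^sup>2 * b / (b + 1)\<^sup>2 \<le> n\<^sup>2 / (b + 1)"
    using b0 by (simp add: divide_simps power2_eq_square) (simp add: algebra_simps)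
  ultimately have "n\<^sup>2 / (b + 1) \<le> 0" by simp
  then have "n = 0" using b0 by (simp add: divide_le_0_iff)
  then have "T w = m *\<^sub>R w" by (simp add: n_def y_def)
  moreover have "w \<noteq> 0" using ww by auto
  ultimately show thesis using that w by blast
qed

text \<open>If the eigenvectors in \<open>A\<close> did not span \<open>A\<close>, their orthogonal
  complement within \<open>A\<close> would be nonzero and invariant, hence contain an eigenvector
  orthogonal to itself. Indexing by eigenvalue merges the summands that share one;
  \<open>f \<mu>\<close> may be zero.\<close>

lemma symmetric_eigen_decomposition:
  fixes T :: "'a::euclidean_space \<Rightarrow> 'a"
  assumes lin: "linear T" and sub: "subspace A" and inv: "\<And>x. x \<in> A \<Longrightarrow> T x \<in> A"
    and sym: "\<And>x y. T x \<bullet> y = x \<bullet> T y" and v: "v \<in> A"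
  obtains \<Lambda> f where "finite \<Lambda>" "\<And>\<mu>. f \<mu> \<in> A" "\<And>\<mu>. T (f \<mu>) = \<mu> *\<^sub>R f \<mu>" "v = (\<Sum>\<mu>\<in>\<Lambda>. f \<mu>)"
proof -
  interpret T: linear T by fact
  define Ev where "Ev = {w \<in> A. \<exists>\<mu>. T w = \<mu> *\<^sub>R w}"
  have EvA: "span Ev \<subseteq> A" using sub by (intro span_minimal) (auto simp: Ev_def)
  have "A \<subseteq> span Ev"
  proof (rule ccontr)
    assume "\<not> A \<subseteq> span Ev"
    then obtain x where x: "x \<in> A" "x \<notin> span Ev" by blast
    obtain p q where pq: "p \<in> span Ev" "\<And>w. w \<in> span Ev \<Longrightarrow> orthogonal q w" "x = p + q"
      using orthogonal_subspace_decomp_exists[of Ev x] by metis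
    define B where "B = A \<inter> (span Ev)\<^sup>\<bottom>"
    have "q = x - p" using pq by simp
    moreover have "x - p \<in> A" using x pq EvA sub by (blast intro: subspace_diff)
    ultimately have "q \<in> A" by (rule ssubst)
    moreover have "q \<noteq> 0" using x pq by auto
    moreover have "q \<in> (span Ev)\<^sup>\<bottom>"
      using pq by (auto simp: orthogonal_comp_def orthogonal_def inner_commute)
    ultimately have q: "q \<in> B" "q \<noteq> 0" by (auto simp: B_def)
    have invE: "T w \<in> span Ev" if "w \<in> span Ev" for w
      using that
    proof (induction rule: span_induct)
      case base
      show ?case by (simp add: subspace_def T.add T.scale T.zero span_add span_scale span_zero)
    next
      case (step y)
      then obtain \<mu> where "T y = \<mu> *\<^sub>R y" by (auto simp: Ev_def)
      then show ?case using step by (simp add: span_scale span_base)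
    qed
    have "subspace B" unfolding B_def by (intro subspace_inter sub subspace_orthogonal_comp)
    moreover have "T y \<in> B" if "y \<in> B" for y
      using that inv invE by (auto simp: B_def orthogonal_comp_def orthogonal_def sym[symmetric])
    ultimately obtain w \<mu> where w: "w \<in> B" "w \<noteq> 0" "T w = \<mu> *\<^sub>R w"
      using symmetric_eigenvector[OF lin _ _ sym q] by blast
    then have "w \<in> span Ev" by (auto simp: B_def Ev_def intro: span_base)
    then have "w \<bullet> w = 0" using w by (auto simp: B_def orthogonal_comp_def orthogonal_def)
    then show False using w by simp
  qed
  \<comment> \<open>Vanishing of \<open>f\<close> outside \<open>\<Lambda>\<close> is added so that
    two decompositions can be summed over the union of their index sets.\<close>
  define P where "P = (\<lambda>v. \<exists>\<Lambda> f. finite \<Lambda> \<and> (\<forall>\<mu>. f \<mu> \<in> A \<and> T (f \<mu>) = \<mu> *\<^sub>R f \<mu>) \<and>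
    (\<forall>\<mu>. \<mu> \<notin> \<Lambda> \<longrightarrow> f \<mu> = 0) \<and> v = (\<Sum>\<mu>\<in>\<Lambda>. f \<mu>))"
  have "v \<in> span Ev" using v \<open>A \<subseteq> span Ev\<close> by blast
  then have "P v"
  proof (induction rule: span_induct)
    case base
    have "P 0" unfolding P_def
      by (rule exI[of _ "{}"], rule exI[of _ "\<lambda>_. 0"]) (simp add: T.zero subspace_0[OF sub])
    moreover have "P (x + y)" if "P x" "P y" for x y
    proof -
      obtain \<Lambda> f where 1: "finite \<Lambda>" "\<And>\<mu>. f \<mu> \<in> A" "\<And>\<mu>. T (f \<mu>) = \<mu> *\<^sub>R f \<mu>"
         "\<And>\<mu>. \<mu> \<notin> \<Lambda> \<Longrightarrow> f \<mu> = 0" "x = (\<Sum>\<mu>\<in>\<Lambda>. f \<mu>)"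
        using \<open>P x\<close> unfolding P_def by blast
      obtain \<Lambda>' f' where 2: "finite \<Lambda>'" "\<And>\<mu>. f' \<mu> \<in> A" "\<And>\<mu>. T (f' \<mu>) = \<mu> *\<^sub>R f' \<mu>"
         "\<And>\<mu>. \<mu> \<notin> \<Lambda>' \<Longrightarrow> f' \<mu> = 0" "y = (\<Sum>\<mu>\<in>\<Lambda>'. f' \<mu>)"
        using \<open>P y\<close> unfolding P_def by blast
      have "x = (\<Sum>\<mu>\<in>\<Lambda> \<union> \<Lambda>'. f \<mu>)" "y = (\<Sum>\<mu>\<in>\<Lambda> \<union> \<Lambda>'. f' \<mu>)"
        using 1 2 by (auto intro!: sum.mono_neutral_left)
      then have "x + y = (\<Sum>\<mu>\<in>\<Lambda> \<union> \<Lambda>'. f \<mu> + f' \<mu>)" by (simp add: sum.distrib)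
      then show ?thesis unfolding P_def using 1 2
        by (intro exI[of _ "\<Lambda> \<union> \<Lambda>'"] exI[of _ "\<lambda>\<mu>. f \<mu> + f' \<mu>"])
           (auto simp: T.add scaleR_add_right intro: subspace_add[OF sub])
    qed
    moreover have "P (c *\<^sub>R x)" if "P x" for x c
    proof -
      obtain \<Lambda> f where 1: "finite \<Lambda>" "\<And>\<mu>. f \<mu> \<in> A" "\<And>\<mu>. T (f \<mu>) = \<mu> *\<^sub>R f \<mu>"
         "\<And>\<mu>. \<mu> \<notin> \<Lambda> \<Longrightarrow> f \<mu> = 0" "x = (\<Sum>\<mu>\<in>\<Lambda>. f \<mu>)"
        using \<open>P x\<close> unfolding P_def by blast
      then show ?thesis unfolding P_def
        by (intro exI[of _ "\<Lambda>"] exI[of _ "\<lambda>\<mu>. c *\<^sub>R f \<mu>"])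
           (auto simp: T.scale scaleR_sum_right intro: subspace_scale[OF sub])
    qed
    ultimately show ?case by (simp add: subspace_def)
  next
    case (step y)
    then obtain \<mu> where "y \<in> A" "T y = \<mu> *\<^sub>R y" by (auto simp: Ev_def)
    then show ?case unfolding P_def
      by (intro exI[of _ "{\<mu>}"] exI[of _ "\<lambda>\<nu>. if \<nu> = \<mu> then y else 0"])
         (auto simp: T.zero subspace_0[OF sub])
  qed
  then show thesis using that unfolding P_def by blast
qed

section \<open>Subalgebras of Euclidean Jordan algebras and their cones of squares\<close>

definition squares_of :: "('a \<Rightarrow> 'a \<Rightarrow> 'a) \<Rightarrow> 'a set \<Rightarrow> 'a set" where
  "squares_of jp W = (\<lambda>x. jp x x) ` W"

context euclidean_jordan_algebra
begin

section \<open>Polarised Jordan identities and the Peirce relation of an idempotent\<close>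

lemmas jp_simps =
  bilinear_ladd[OF jp_bilinear] bilinear_radd[OF jp_bilinear]
  bilinear_lsub[OF jp_bilinear] bilinear_rsub[OF jp_bilinear]
  bilinear_lmul[OF jp_bilinear] bilinear_rmul[OF jp_bilinear]
  bilinear_lzero[OF jp_bilinear] bilinear_rzero[OF jp_bilinear]
  bilinear_lneg[OF jp_bilinear] bilinear_rneg[OF jp_bilinear]

lemma linear_jp: "linear (jp x)"
  using jp_bilinear by (simp add: bilinear_def)

lemma jp_sum_right: "jp x (sum f I) = (\<Sum>i\<in>I. jp x (f i))"
  using linear_jp by (rule linear_sum)

lemma jp_sum_left: "jp (sum f I) x = (\<Sum>i\<in>I. jp (f i) x)"
  using jp_sum_right[of x f I] by (simp add: jp_commute)

lemma jp_sym: "jp x y \<bullet> z = y \<bullet> jp x z"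
  by (metis jp_commute jp_inner)

text \<open>The part of the Jordan identity that is linear in \<open>z\<close>: the difference of
  its instances at \<open>x + z\<close> and \<open>x - z\<close> keeps the odd degrees in
  \<open>z\<close>, and the instance at \<open>z\<close> removes the cubic one. Pairing with an
  arbitrary \<open>v\<close> reduces this to real linear arithmetic.\<close>

lemma jordan_linearized:
  "jp z (jp (jp x x) y) + 2 *\<^sub>R jp x (jp (jp x z) y) = 2 *\<^sub>R jp (jp x z) (jp x y) + jp (jp x x) (jp z y)"
  (is "?l = ?r")
proof -
  have "v \<bullet> ?l = v \<bullet> ?r" for v
    using arg_cong[OF jp_jordan[of "x + z" y], of "inner v"]
      arg_cong[OF jp_jordan[of "x - z" y], of "inner v"] arg_cong[OF jp_jordan[of z y], of "inner v"]
    by (simp add: jp_simps jp_commute[of z x] inner_simps)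
  then show ?thesis using vector_eq_ldot by blast
qed

text \<open>The linearised identity polarised in \<open>x\<close>: its value at \<open>x + w\<close>
  minus those at \<open>x\<close> and at \<open>w\<close>, halved.\<close>

lemma jordan_polarized:
  "jp z (jp (jp x w) y) + jp x (jp (jp w z) y) + jp w (jp (jp x z) y)
   = jp (jp x z) (jp w y) + jp (jp w z) (jp x y) + jp (jp x w) (jp z y)"
  (is "?l = ?r")
proof -
  have "v \<bullet> ?l = v \<bullet> ?r" for v
    using arg_cong[OF jordan_linearized[of z "x + w" y], of "inner v"]
      arg_cong[OF jordan_linearized[of z x y], of "inner v"]
      arg_cong[OF jordan_linearized[of z w y], of "inner v"]
    by (simp add: jp_simps jp_commute[of w x] inner_simps)
  then show ?thesis using vector_eq_ldot by blast
qed

text \<open>The Peirce polynomial of \<open>c\<close>: it confines the eigenvalues of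
  \<open>jp c\<close> to 0, 1/2 and 1.\<close>

lemma idempotent_cubic:
  assumes "idempotent jp c"
  shows "2 *\<^sub>R jp c (jp c (jp c z)) = 3 *\<^sub>R jp c (jp c z) - jp c z"
proof -
  have "jp c z + 2 *\<^sub>R jp c (jp c (jp c z)) = 2 *\<^sub>R jp c (jp c z) + jp c (jp c z)"
    using jordan_linearized[of z c c] assms by (simp add: idempotent_def jp_commute[of z c] jp_commute[of "jp c z" c])
  also have "\<dots> = 3 *\<^sub>R jp c (jp c z)"
    using scaleR_add_left[of 2 1 "jp c (jp c z)"] by simp
  finally show ?thesis by (simp add: algebra_simps)
qed

text \<open>No Peirce decomposition is formed. The numbers \<open>p\<close>, \<open>q\<close>,
  \<open>r\<close>, \<open>s\<close> are the moments of the first four powers of \<open>jp c\<close>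
  at \<open>x\<close>. The cubic relation expresses \<open>p\<close> and \<open>s\<close> through
  \<open>q\<close> and \<open>r\<close>; then \<open>q - 2 * r + s \<ge> 0\<close> says
  \<open>r \<le> q\<close>, so \<open>p = 3 * q - 2 * r \<ge> q \<ge> 0\<close>.\<close>

lemma idempotent_psd:
  assumes "idempotent jp c"
  shows "0 \<le> x \<bullet> jp c x"
proof -
  define p where "p = x \<bullet> jp c x"
  define q where "q = jp c x \<bullet> jp c x"
  define r where "r = jp c x \<bullet> jp c (jp c x)"
  define s where "s = jp c (jp c x) \<bullet> jp c (jp c x)"
  have "2 * r = x \<bullet> 2 *\<^sub>R jp c (jp c (jp c x))"
    by (simp add: r_def jp_sym)
  also have "\<dots> = 3 * q - p"
    by (simp add: idempotent_cubic[OF assms] inner_simps p_def q_def jp_sym)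
  finally have 1: "2 * r = 3 * q - p" .
  have "2 * s = jp c x \<bullet> 2 *\<^sub>R jp c (jp c (jp c x))"
    by (simp add: s_def jp_sym)
  also have "\<dots> = 3 * r - q"
    by (simp add: idempotent_cubic[OF assms] inner_simps r_def q_def)
  finally have 2: "2 * s = 3 * r - q" .
  have "0 \<le> (jp c x - jp c (jp c x)) \<bullet> (jp c x - jp c (jp c x))" by simp
  also have "\<dots> = q - 2 * r + s"
    by (simp add: inner_simps q_def r_def s_def inner_commute)
  finally show ?thesis using 1 2 inner_ge_zero[of "jp c x"] unfolding p_def q_def[symmetric]
    by linarith
qed

end

text \<open>The unit \<open>u\<close> of the subalgebra need not be \<open>e\<close>: passing to the
  Peirce 0-space of an idempotent \<open>c\<close> replaces \<open>u\<close> by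
  \<open>u - c\<close>.\<close>

locale jordan_subalgebra = euclidean_jordan_algebra jp e
  for jp :: "'a::euclidean_space \<Rightarrow> 'a \<Rightarrow> 'a" and e :: 'a +
  fixes W :: "'a set" and u :: 'a
  assumes W_subspace: "subspace W"
    and W_closed: "x \<in> W \<Longrightarrow> y \<in> W \<Longrightarrow> jp x y \<in> W"
    and u_in: "u \<in> W"
    and u_unit: "x \<in> W \<Longrightarrow> jp u x = x"
begin

section \<open>The spectral theorem inside a subalgebra\<close>

definition commuting :: "'a \<Rightarrow> 'a set" where
  "commuting x = {p \<in> W. \<forall>w\<in>W. jp p (jp x w) = jp x (jp p w) \<and>
                    jp p (jp (jp x x) w) = jp (jp x x) (jp p w)}"

lemma commuting_subspace: "subspace (commuting x)"
  using W_subspace by (auto simp: subspace_def commuting_def jp_simps)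

text \<open>Commutation of \<open>p\<close> with the square of \<open>x\<close> makes two terms of
  the linearised identity cancel, leaving that \<open>jp x p\<close> commutes with \<open>x\<close>.
  The polarised identity at the square of \<open>x\<close>, \<open>x\<close> and \<open>p\<close>
  says that three commutators add up to zero; two of them vanish because multiplication by the cube
  of \<open>x\<close> and by \<open>jp (jp x x) p\<close> are polynomials in operators whose
  commutation is known, so the third, that of \<open>jp x p\<close> with the square of
  \<open>x\<close>, vanishes too.\<close>

lemma commuting_invariant:
  assumes x: "x \<in> W" and p: "p \<in> commuting x"
  shows "jp x p \<in> commuting x"
proof -
  let ?x2 = "jp x x" and ?q = "jp x p"
  note mem = W_closed x
  have pW: "p \<in> W" using p by (simp add: commuting_def)
  have px: "\<And>w. w \<in> W \<Longrightarrow> jp p (jp x w) = jp x (jp p w)"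
    and px2: "\<And>w. w \<in> W \<Longrightarrow> jp p (jp ?x2 w) = jp ?x2 (jp p w)"
    using p by (auto simp: commuting_def)
  have xx2: "jp ?x2 (jp x w) = jp x (jp ?x2 w)" for w by (simp add: jp_jordan)
  have qx: "jp ?q (jp x w) = jp x (jp ?q w)" if "w \<in> W" for w
    using jordan_linearized[of p x w] px2[OF that] by simp
  have x3: "jp (jp ?x2 x) w = 3 *\<^sub>R jp ?x2 (jp x w) - 2 *\<^sub>R jp x (jp x (jp x w))" for w
    using jordan_linearized[of w x x] scaleR_add_left[of 2 1 "jp ?x2 (jp x w)"]
    by (simp add: jp_commute[of w] jp_commute[of "jp x w"] algebra_simps)
  have x2p: "jp (jp ?x2 p) w = jp ?x2 (jp p w) + 2 *\<^sub>R jp ?q (jp x w) - 2 *\<^sub>R jp x (jp p (jp x w))" for w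
    using jordan_linearized[of w x p]
    by (simp add: jp_commute[of w] jp_commute[of "jp x w"] algebra_simps)
  have px3: "jp p (jp (jp ?x2 x) w) = jp (jp ?x2 x) (jp p w)" if w: "w \<in> W" for w
    using that by (simp add: x3 jp_simps px px2 mem)
  have x2px: "jp (jp ?x2 p) (jp x w) = jp x (jp (jp ?x2 p) w)" if w: "w \<in> W" for w
    using that by (simp add: x2p jp_simps px px2 qx xx2 mem pW)
  have "jp ?q (jp ?x2 w) = jp ?x2 (jp ?q w)" if w: "w \<in> W" for w
    using jordan_polarized[of "?x2" x p w] px3[OF w] x2px[OF w]
    by (simp add: jp_commute[of x ?x2] jp_commute[of p ?x2])
  then show ?thesis
    using qx W_closed[OF x pW] by (simp add: commuting_def)
qed

text \<open>The eigenvectors of \<open>y \<mapsto> jp x y\<close> that make up the unit have to be taken in a set whose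
  elements operator-commute with \<open>x\<close>; this is what makes them orthogonal idempotents.\<close>

lemma spectral_decomposition:
  assumes x: "x \<in> W"
  obtains \<Lambda> c where "finite \<Lambda>" "\<And>\<mu>. \<mu> \<in> \<Lambda> \<Longrightarrow> c \<mu> \<in> W" "\<And>\<mu>. \<mu> \<in> \<Lambda> \<Longrightarrow> idempotent jp (c \<mu>)"
    "\<And>\<mu> \<nu>. \<mu> \<in> \<Lambda> \<Longrightarrow> \<nu> \<in> \<Lambda> \<Longrightarrow> \<mu> \<noteq> \<nu> \<Longrightarrow> jp (c \<mu>) (c \<nu>) = 0"
    "\<And>\<mu>. \<mu> \<in> \<Lambda> \<Longrightarrow> jp x (c \<mu>) = \<mu> *\<^sub>R c \<mu>" "x = (\<Sum>\<mu>\<in>\<Lambda>. \<mu> *\<^sub>R c \<mu>)"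
proof -
  have u: "u \<in> commuting x"
    using x u_in u_unit W_closed by (simp add: commuting_def)
  obtain \<Lambda> c where c: "finite \<Lambda>" "\<And>\<mu>. c \<mu> \<in> commuting x" "\<And>\<mu>. jp x (c \<mu>) = \<mu> *\<^sub>R c \<mu>"
      "u = (\<Sum>\<mu>\<in>\<Lambda>. c \<mu>)"
    by (rule symmetric_eigen_decomposition[OF linear_jp commuting_subspace
          commuting_invariant[OF x] jp_sym u]) blast+
  have W: "c \<mu> \<in> W" for \<mu> using c(2)[of \<mu>] by (simp add: commuting_def)
  have orth: "jp (c \<mu>) (c \<nu>) = 0" if "\<mu> \<noteq> \<nu>" for \<mu> \<nu>
  proof -
    \<comment> \<open>Operator commutation lets \<open>x\<close> act on the product through either
      factor, so the product belongs to both eigenvalues \<open>\<mu>\<close> and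
      \<open>\<nu>\<close>.\<close>
    have "\<nu> *\<^sub>R jp (c \<mu>) (c \<nu>) = jp x (jp (c \<mu>) (c \<nu>))" for \<mu> \<nu>
    proof -
      have "jp (c \<mu>) (jp x (c \<nu>)) = jp x (jp (c \<mu>) (c \<nu>))"
        using c(2)[of \<mu>] W[of \<nu>] by (simp add: commuting_def)
      then show ?thesis by (simp add: c(3) jp_simps)
    qed
    from this[of \<nu> \<mu>] this[of \<mu> \<nu>] have "(\<nu> - \<mu>) *\<^sub>R jp (c \<mu>) (c \<nu>) = 0"
      by (simp add: jp_commute[of "c \<nu>"] scaleR_left_diff_distrib)
    then show ?thesis using that by simp
  qed
  have "c \<mu> = jp (c \<mu>) (c \<mu>)" if "\<mu> \<in> \<Lambda>" for \<mu>
  proof -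
    have "c \<mu> = jp u (c \<mu>)" using u_unit W by simp
    also have "\<dots> = (\<Sum>\<nu>\<in>\<Lambda>. jp (c \<nu>) (c \<mu>))" by (simp add: c(4) jp_sum_left)
    also have "\<dots> = (\<Sum>\<nu>\<in>\<Lambda>. if \<nu> = \<mu> then jp (c \<mu>) (c \<mu>) else 0)"
      by (intro sum.cong) (auto simp: orth)
    finally show ?thesis using that c(1) by simp
  qed
  moreover have "x = (\<Sum>\<mu>\<in>\<Lambda>. \<mu> *\<^sub>R c \<mu>)"
  proof -
    have "x = jp x u" using u_unit x jp_commute by metis
    then show ?thesis by (simp add: c(3,4) jp_sum_right)
  qed
  ultimately show thesis using that[of \<Lambda> c] c W orth by (simp add: idempotent_def)
qed

text \<open>Indexing by the eigenvalues of a square root of \<open>y\<close> makes the coefficients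
  visibly nonnegative; different indices may share a coefficient.\<close>

lemma square_decomposition:
  assumes y: "y \<in> squares_of jp W"
  obtains \<Lambda> c where "finite \<Lambda>" "\<And>\<mu>. \<mu> \<in> \<Lambda> \<Longrightarrow> c \<mu> \<in> W" "\<And>\<mu>. \<mu> \<in> \<Lambda> \<Longrightarrow> idempotent jp (c \<mu>)"
    "\<And>\<mu> \<nu>. \<mu> \<in> \<Lambda> \<Longrightarrow> \<nu> \<in> \<Lambda> \<Longrightarrow> \<mu> \<noteq> \<nu> \<Longrightarrow> jp (c \<mu>) (c \<nu>) = 0" "y = (\<Sum>\<mu>\<in>\<Lambda>. \<mu>\<^sup>2 *\<^sub>R c \<mu>)"
proof -
  obtain v where v: "v \<in> W" "y = jp v v" using y by (auto simp: squares_of_def)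
  obtain \<Lambda> c where c: "finite \<Lambda>" "\<And>\<mu>. \<mu> \<in> \<Lambda> \<Longrightarrow> c \<mu> \<in> W" "\<And>\<mu>. \<mu> \<in> \<Lambda> \<Longrightarrow> idempotent jp (c \<mu>)"
    "\<And>\<mu> \<nu>. \<mu> \<in> \<Lambda> \<Longrightarrow> \<nu> \<in> \<Lambda> \<Longrightarrow> \<mu> \<noteq> \<nu> \<Longrightarrow> jp (c \<mu>) (c \<nu>) = 0"
    "\<And>\<mu>. \<mu> \<in> \<Lambda> \<Longrightarrow> jp v (c \<mu>) = \<mu> *\<^sub>R c \<mu>" "v = (\<Sum>\<mu>\<in>\<Lambda>. \<mu> *\<^sub>R c \<mu>)"
    by (rule spectral_decomposition[OF v(1)]) (rule that)
  have "y = jp v (\<Sum>\<mu>\<in>\<Lambda>. \<mu> *\<^sub>R c \<mu>)" using v c(6) by simp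
  also have "\<dots> = (\<Sum>\<mu>\<in>\<Lambda>. \<mu>\<^sup>2 *\<^sub>R c \<mu>)"
    unfolding jp_sum_right by (intro sum.cong) (simp_all add: jp_simps c(5) power2_eq_square)
  finally show thesis using that c by blast
qed

section \<open>Self-duality of the cone of squares\<close>

lemma square_inner_idempotent_nonneg:
  assumes "y \<in> squares_of jp W" "idempotent jp c"
  shows "0 \<le> y \<bullet> c"
proof -
  obtain v where "y = jp v v" using assms by (auto simp: squares_of_def)
  then have "y \<bullet> c = v \<bullet> jp c v" by (simp add: jp_sym jp_commute[of c])
  then show ?thesis using idempotent_psd[OF assms(2)] by simp
qed

lemma squares_inner_nonneg:
  assumes "x \<in> squares_of jp W" "y \<in> squares_of jp W"
  shows "0 \<le> x \<bullet> y"
proof -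
  obtain \<Lambda> c where c: "finite \<Lambda>" "\<And>\<mu>. \<mu> \<in> \<Lambda> \<Longrightarrow> idempotent jp (c \<mu>)" "y = (\<Sum>\<mu>\<in>\<Lambda>. \<mu>\<^sup>2 *\<^sub>R c \<mu>)"
    by (rule square_decomposition[OF assms(2)]) (rule that)
  then show ?thesis
    using square_inner_idempotent_nonneg[OF assms(1)]
    by (auto simp: inner_sum_right intro!: sum_nonneg)
qed

text \<open>Testing against the spectral idempotents of \<open>x\<close> shows that its eigenvalues
  are nonnegative, and their square roots assemble to a square root of \<open>x\<close>.\<close>

lemma squares_dualI:
  assumes x: "x \<in> W" and nonneg: "\<And>w. w \<in> W \<Longrightarrow> 0 \<le> x \<bullet> jp w w"
  shows "x \<in> squares_of jp W"
proof -
  obtain \<Lambda> c where c: "finite \<Lambda>" "\<And>\<mu>. \<mu> \<in> \<Lambda> \<Longrightarrow> c \<mu> \<in> W" "\<And>\<mu>. \<mu> \<in> \<Lambda> \<Longrightarrow> idempotent jp (c \<mu>)"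
    "\<And>\<mu> \<nu>. \<mu> \<in> \<Lambda> \<Longrightarrow> \<nu> \<in> \<Lambda> \<Longrightarrow> \<mu> \<noteq> \<nu> \<Longrightarrow> jp (c \<mu>) (c \<nu>) = 0"
    "\<And>\<mu>. \<mu> \<in> \<Lambda> \<Longrightarrow> jp x (c \<mu>) = \<mu> *\<^sub>R c \<mu>" "x = (\<Sum>\<mu>\<in>\<Lambda>. \<mu> *\<^sub>R c \<mu>)"
    by (rule spectral_decomposition[OF x]) (rule that)
  \<comment> \<open>A \<open>c \<mu>\<close> may be zero, and then \<open>\<mu>\<close> can be
    negative; the absolute value covers this case.\<close>
  have pos: "\<bar>\<mu>\<bar> *\<^sub>R c \<mu> = \<mu> *\<^sub>R c \<mu>" if "\<mu> \<in> \<Lambda>" for \<mu>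
  proof (cases "c \<mu> = 0")
    case False
    have id: "jp (c \<mu>) (c \<mu>) = c \<mu>" using c(3)[OF that] by (simp add: idempotent_def)
    have "0 \<le> x \<bullet> jp (c \<mu>) (c \<mu>)" by (rule nonneg[OF c(2)[OF that]])
    also have "\<dots> = \<mu> * (c \<mu> \<bullet> c \<mu>)"
      using jp_inner[of x "c \<mu>" "c \<mu>"] c(5)[OF that] id by simp
    finally have "\<mu> \<ge> 0" using False by (simp add: zero_le_mult_iff) (meson inner_gt_zero_iff not_less)
    then show ?thesis by simp
  qed simp
  define y where "y = (\<Sum>\<mu>\<in>\<Lambda>. sqrt \<bar>\<mu>\<bar> *\<^sub>R c \<mu>)"
  have "jp y (c \<mu>) = sqrt \<bar>\<mu>\<bar> *\<^sub>R c \<mu>" if "\<mu> \<in> \<Lambda>" for \<mu>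
  proof -
    have "jp y (c \<mu>) = (\<Sum>\<nu>\<in>\<Lambda>. if \<nu> = \<mu> then sqrt \<bar>\<mu>\<bar> *\<^sub>R c \<mu> else 0)"
      unfolding y_def jp_sum_left using c(3,4) that
      by (intro sum.cong) (auto simp: jp_simps idempotent_def)
    then show ?thesis using that c(1) by simp
  qed
  then have "jp y y = (\<Sum>\<mu>\<in>\<Lambda>. \<bar>\<mu>\<bar> *\<^sub>R c \<mu>)"
    by (subst (2) y_def, unfold jp_sum_right) (intro sum.cong, simp_all add: jp_simps)
  also have "\<dots> = x" unfolding c(6) by (intro sum.cong refl pos)
  finally have "x = jp y y" ..
  moreover have "y \<in> W" unfolding y_def
    using c(2) W_subspace by (auto intro!: subspace_sum subspace_scale)
  ultimately show ?thesis by (auto simp: squares_of_def)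
qed

lemma squares_subset: "squares_of jp W \<subseteq> W"
  using W_closed by (auto simp: squares_of_def)

text \<open>Self-duality within \<open>W\<close>; closedness and convexity of the cone are read off
  from this intersection of halfspaces.\<close>

lemma squares_eq_dual: "squares_of jp W = W \<inter> (\<Inter>w\<in>W. {x. 0 \<le> jp w w \<bullet> x})"
  using squares_subset squares_inner_nonneg squares_dualI
  by (fastforce simp: squares_of_def inner_commute)

lemma squares_closed: "closed (squares_of jp W)"
  unfolding squares_eq_dual
  by (intro closed_Int closed_INT ballI closed_halfspace_ge closed_subspace W_subspace)

lemma squares_convex_cone: "convex_cone (squares_of jp W)"
  unfolding convex_cone_iff squares_eq_dual using W_subspace
  by (auto simp: subspace_def inner_simps)

text \<open>\<open>c\<close> is the support of \<open>z\<close>, the sum of its spectral idempotents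
  with nonzero coefficient; \<open>m\<close> and \<open>M\<close> are bounds for these
  coefficients.\<close>

lemma square_support:
  assumes z: "z \<in> squares_of jp W"
  obtains c m M where "c \<in> W" "idempotent jp c" "m > 0"
    "\<And>y. y \<in> squares_of jp W \<Longrightarrow> m * (y \<bullet> c) \<le> y \<bullet> z \<and> y \<bullet> z \<le> M * (y \<bullet> c)"
proof -
  obtain \<Lambda> c where c: "finite \<Lambda>" "\<And>\<mu>. \<mu> \<in> \<Lambda> \<Longrightarrow> c \<mu> \<in> W" "\<And>\<mu>. \<mu> \<in> \<Lambda> \<Longrightarrow> idempotent jp (c \<mu>)"
    "\<And>\<mu> \<nu>. \<mu> \<in> \<Lambda> \<Longrightarrow> \<nu> \<in> \<Lambda> \<Longrightarrow> \<mu> \<noteq> \<nu> \<Longrightarrow> jp (c \<mu>) (c \<nu>) = 0" "z = (\<Sum>\<mu>\<in>\<Lambda>. \<mu>\<^sup>2 *\<^sub>R c \<mu>)"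
    by (rule square_decomposition[OF z]) (rule that)
  define \<Lambda>' where "\<Lambda>' = \<Lambda> - {0}"
  define d where "d = (\<Sum>\<mu>\<in>\<Lambda>'. c \<mu>)"
  \<comment> \<open>The element 1 keeps \<open>Min S\<close> and \<open>Max S\<close> meaningful
    when \<open>z = 0\<close>.\<close>
  define S where "S = insert 1 ((\<lambda>\<mu>. \<mu>\<^sup>2) ` \<Lambda>')"
  have S: "finite S" "S \<noteq> {}" using c(1) by (auto simp: S_def \<Lambda>'_def)
  have z': "z = (\<Sum>\<mu>\<in>\<Lambda>'. \<mu>\<^sup>2 *\<^sub>R c \<mu>)"
    unfolding c(5) \<Lambda>'_def using c(1) by (intro sum.mono_neutral_right) auto
  have "jp d (c \<mu>) = c \<mu>" if "\<mu> \<in> \<Lambda>'" for \<mu>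
  proof -
    have "jp d (c \<mu>) = (\<Sum>\<nu>\<in>\<Lambda>'. if \<nu> = \<mu> then c \<mu> else 0)"
      unfolding d_def jp_sum_left using c(3,4) that
      by (intro sum.cong) (auto simp: idempotent_def \<Lambda>'_def)
    then show ?thesis using that c(1) by (simp add: \<Lambda>'_def)
  qed
  then have "jp d d = d"
    by (subst (2) d_def, unfold jp_sum_right) (simp add: d_def)
  then have "idempotent jp d" by (simp add: idempotent_def)
  moreover have "d \<in> W"
    unfolding d_def using c(2) W_subspace by (auto simp: \<Lambda>'_def intro!: subspace_sum)
  moreover have "Min S > 0"
    using S by (simp add: S_def \<Lambda>'_def)
  moreover have "Min S * (y \<bullet> d) \<le> y \<bullet> z \<and> y \<bullet> z \<le> Max S * (y \<bullet> d)" if y: "y \<in> squares_of jp W" for y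
  proof -
    have nn: "0 \<le> y \<bullet> c \<mu>" if "\<mu> \<in> \<Lambda>'" for \<mu>
      using square_inner_idempotent_nonneg[OF y c(3)] that by (simp add: \<Lambda>'_def)
    have "Min S \<le> \<mu>\<^sup>2" "\<mu>\<^sup>2 \<le> Max S" if "\<mu> \<in> \<Lambda>'" for \<mu>
      using S that by (simp_all add: S_def)
    then show ?thesis
      unfolding z' d_def inner_sum_right sum_distrib_left inner_scaleR_right
      by (auto intro!: sum_mono mult_right_mono nn)
  qed
  ultimately show thesis using that by blast
qed

section \<open>Faces exposed by dual vectors, and their residual bounds\<close>

lemma norm_jp_idempotent_square:
  assumes c: "c \<in> W" "idempotent jp c" and y: "y \<in> squares_of jp W"
    and B: "B > 0" "\<And>x y. norm (jp x y) \<le> B * norm x * norm y"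
  shows "(norm (jp c y))\<^sup>2 \<le> B * norm y * (y \<bullet> c)"
proof (cases "y = 0")
  case False
  define h where "h = jp c y"
  define N where "N = (norm h)\<^sup>2"
  \<comment> \<open>With this \<open>s\<close> the quadratic term of the pairing is at most
    \<open>s * N\<close>, half of the linear term \<open>2 * s * N\<close>.\<close>
  define s where "s = 1 / (B * norm y)"
  have s: "s > 0" "s * (B * norm y) = 1" using False B by (simp_all add: s_def)
  have "h \<in> W" unfolding h_def using c y squares_subset W_closed by blast
  then have "jp (c - s *\<^sub>R h) (c - s *\<^sub>R h) \<in> squares_of jp W"
    using c W_subspace by (auto simp: squares_of_def intro!: imageI subspace_diff subspace_scale)
  from squares_inner_nonneg[OF y this]
  have "0 \<le> y \<bullet> c - 2 * s * (y \<bullet> jp c h) + s\<^sup>2 * (y \<bullet> jp h h)"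
    using c(2) by (simp add: jp_simps inner_simps jp_commute[of h c] idempotent_def
        power2_eq_square algebra_simps)
  also have "y \<bullet> jp c h = N"
    using jp_sym[of c y h] by (simp add: h_def N_def power2_norm_eq_inner)
  also have "y \<bullet> jp h h \<le> norm y * (B * N)"
    using norm_cauchy_schwarz[of y "jp h h"] mult_left_mono[OF B(2)[of h h] norm_ge_zero[of y]]
    by (simp add: N_def power2_eq_square algebra_simps)
  finally have "0 \<le> y \<bullet> c - 2 * s * N + s\<^sup>2 * (norm y * (B * N))"
    by (simp add: mult_left_mono)
  also have "s\<^sup>2 * (norm y * (B * N)) = s * N * (s * (B * norm y))"
    by (simp add: power2_eq_square)
  finally have "s * N \<le> y \<bullet> c" using s by (simp add: mult.commute)
  then have "(s * (B * norm y)) * N \<le> B * norm y * (y \<bullet> c)"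
    using mult_left_mono[of "s * N" "y \<bullet> c" "B * norm y"] B by (simp add: mult_ac)
  then show ?thesis using s by (simp add: N_def h_def)
qed (simp add: jp_simps)

text \<open>By the linearised identity an element annihilated by \<open>c\<close> operator-commutes
  with \<open>c\<close>, so products of such elements are annihilated as well.\<close>

lemma peirce_zero_subalgebra:
  assumes c: "c \<in> W" "idempotent jp c"
  shows "jordan_subalgebra jp e {w \<in> W. jp c w = 0} (u - c)"
proof
  show "subspace {w \<in> W. jp c w = 0}"
    using W_subspace by (auto simp: subspace_def jp_simps)
  fix x y assume x: "x \<in> {w \<in> W. jp c w = 0}" and y: "y \<in> {w \<in> W. jp c w = 0}"
  have "jp c (jp x y) = jp x (jp c y)"
    using jordan_linearized[of x c y] c x by (simp add: idempotent_def jp_simps)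
  then show "jp x y \<in> {w \<in> W. jp c w = 0}"
    using x y W_closed by (simp add: jp_simps)
next
  show "u - c \<in> {w \<in> W. jp c w = 0}"
    using c u_in u_unit[of c] W_subspace
    by (auto simp: idempotent_def jp_simps jp_commute[of c u] intro: subspace_diff)
  fix x assume "x \<in> {w \<in> W. jp c w = 0}"
  then show "jp (u - c) x = x" by (simp add: jp_simps u_unit)
qed

text \<open>The polynomial \<open>1 - 3 * t + 2 * t\<^sup>2\<close> is 1 at 0 and vanishes at 1/2
  and 1, so it projects onto the Peirce 0-space. Paired with squares from that space the terms in
  \<open>jp c\<close> drop out, and self-duality of the smaller cone applies.\<close>

lemma peirce_zero_component:
  assumes c: "c \<in> W" "idempotent jp c" and y: "y \<in> squares_of jp W"
  shows "y - 3 *\<^sub>R jp c y + 2 *\<^sub>R jp c (jp c y) \<in> squares_of jp {w \<in> W. jp c w = 0}" (is "?y0 \<in> _")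
proof -
  interpret W': jordan_subalgebra jp e "{w \<in> W. jp c w = 0}" "u - c"
    by (rule peirce_zero_subalgebra[OF c])
  have yW: "y \<in> W" using y squares_subset by blast
  show ?thesis
  proof (rule W'.squares_dualI)
    have "jp c ?y0 = 0"
      by (simp add: jp_simps idempotent_cubic[OF c(2)])
    then show "?y0 \<in> {w \<in> W. jp c w = 0}"
      using W_subspace W_closed c yW by (auto intro!: subspace_add subspace_diff subspace_scale)
  next
    fix w assume w: "w \<in> {w \<in> W. jp c w = 0}"
    then have "jp c (jp w w) = 0" using W'.W_closed by blast
    then have "?y0 \<bullet> jp w w = y \<bullet> jp w w"
      by (simp add: inner_simps jp_sym jp_simps)
    also have "\<dots> \<ge> 0"
      using w squares_inner_nonneg[OF y] by (simp add: squares_of_def)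
    finally show "0 \<le> ?y0 \<bullet> jp w w" .
  qed
qed

text \<open>The dual cone is formed in the whole space, so \<open>z\<close> may lie outside
  \<open>W\<close>; its orthogonal projection to \<open>W\<close> has the same pairings and is a
  square by self-duality.\<close>

lemma dual_cone_representative:
  assumes z: "z \<in> dual_cone (squares_of jp W)"
  obtains z' where "z' \<in> squares_of jp W" "\<And>w. w \<in> W \<Longrightarrow> w \<bullet> z = w \<bullet> z'"
proof -
  obtain p q where pq: "p \<in> span W" "\<And>w. w \<in> span W \<Longrightarrow> orthogonal q w" "z = p + q"
    by (rule orthogonal_subspace_decomp_exists[of W z]) (rule that)
  have eq: "w \<bullet> z = w \<bullet> p" if "w \<in> W" for w
    using pq(2)[of w] that by (simp add: pq(3) inner_add_right orthogonal_def inner_commute span_base)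
  have "p \<in> squares_of jp W"
  proof (rule squares_dualI)
    show "p \<in> W" using pq(1) W_subspace by (simp add: span_eq_iff[THEN iffD2])
    fix w assume "w \<in> W"
    then have "jp w w \<in> W" "jp w w \<in> squares_of jp W" using W_closed by (auto simp: squares_of_def)
    then show "0 \<le> p \<bullet> jp w w"
      using z eq[of "jp w w"] by (auto simp: dual_cone_def inner_commute)
  qed
  then show thesis using that eq by blast
qed

lemma facial_reduction_step:
  assumes z: "z \<in> dual_cone (squares_of jp W)"
  obtains W' u' \<kappa> where "jordan_subalgebra jp e W' u'"
    "squares_of jp W \<inter> {z}\<^sup>\<bottom> = squares_of jp W'" "\<kappa> \<ge> 0"
    "\<And>y. y \<in> squares_of jp W \<Longrightarrow> infdist y (squares_of jp W') \<le> \<kappa> * sqrt (norm y * (y \<bullet> z))"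
proof -
  let ?K = "squares_of jp W"
  obtain z' where z': "z' \<in> ?K" "\<And>w. w \<in> W \<Longrightarrow> w \<bullet> z = w \<bullet> z'"
    by (rule dual_cone_representative[OF z]) (rule that)
  obtain c m M where c: "c \<in> W" "idempotent jp c" "m > 0"
    and mM: "\<And>y. y \<in> ?K \<Longrightarrow> m * (y \<bullet> c) \<le> y \<bullet> z' \<and> y \<bullet> z' \<le> M * (y \<bullet> c)"
    by (rule square_support[OF z'(1)]) (rule that)
  define W' where "W' = {w \<in> W. jp c w = 0}"
  interpret W': jordan_subalgebra jp e W' "u - c"
    unfolding W'_def by (rule peirce_zero_subalgebra[OF c(1,2)])
  obtain B where B: "B > 0" "\<And>x y. norm (jp x y) \<le> B * norm x * norm y"
    using bilinear_bounded_pos[OF jp_bilinear] by blast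
  have nn: "0 \<le> y \<bullet> c" if "y \<in> ?K" for y
    by (rule square_inner_idempotent_nonneg[OF that c(2)])
  have yz: "m * (y \<bullet> c) \<le> y \<bullet> z" "y \<bullet> z \<le> M * (y \<bullet> c)" if "y \<in> ?K" for y
    using mM[OF that] z'(2)[of y] squares_subset that by auto
  have K'K: "squares_of jp W' \<subseteq> ?K"
    by (auto simp: squares_of_def W'_def)
  have K'z: "y \<bullet> z = 0" if y: "y \<in> squares_of jp W'" for y
  proof -
    have yK: "y \<in> ?K" using y K'K by blast
    obtain w where w: "w \<in> W'" "y = jp w w" using y by (auto simp: squares_of_def)
    then have "y \<bullet> c = 0"
      by (simp add: jp_inner jp_commute[of w c] W'_def)
    moreover have "y \<bullet> z \<ge> 0" using z yK by (simp add: dual_cone_def inner_commute)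
    ultimately show ?thesis using yz[OF yK] by simp
  qed
  have bound: "(norm (jp c y))\<^sup>2 \<le> B * norm y * (y \<bullet> z) / m" if y: "y \<in> ?K" for y
  proof -
    have "(norm (jp c y))\<^sup>2 \<le> B * norm y * (y \<bullet> c)"
      by (rule norm_jp_idempotent_square[OF c(1,2) y B])
    also have "\<dots> \<le> B * norm y * ((y \<bullet> z) / m)"
      using yz(1)[OF y] c(3) B by (intro mult_left_mono) (simp_all add: pos_le_divide_eq mult.commute)
    finally show ?thesis by simp
  qed
  have comp: "y - 3 *\<^sub>R jp c y + 2 *\<^sub>R jp c (jp c y) \<in> squares_of jp W'" if "y \<in> ?K" for y
    unfolding W'_def by (rule peirce_zero_component[OF c(1,2) that])
  have "?K \<inter> {z}\<^sup>\<bottom> = squares_of jp W'"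
  proof
    show "squares_of jp W' \<subseteq> ?K \<inter> {z}\<^sup>\<bottom>"
      using K'K K'z by (auto simp: orthogonal_comp_def orthogonal_def inner_commute)
    show "?K \<inter> {z}\<^sup>\<bottom> \<subseteq> squares_of jp W'"
    proof
      fix y assume "y \<in> ?K \<inter> {z}\<^sup>\<bottom>"
      then have y: "y \<in> ?K" "y \<bullet> z = 0"
        by (auto simp: orthogonal_comp_def orthogonal_def inner_commute)
      \<comment> \<open>The bound collapses at \<open>y \<bullet> z = 0\<close>, so \<open>y\<close>
        equals its own Peirce 0-component.\<close>
      then have "jp c y = 0" using bound[OF y(1)] by simp
      then show "y \<in> squares_of jp W'" using comp[OF y(1)] by (simp add: jp_simps)
    qed
  qed
  moreover
  \<comment> \<open>The first factor bounds the removed part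
    \<open>3 *\<^sub>R jp c y - 2 *\<^sub>R jp c (jp c y)\<close> by \<open>norm (jp c y)\<close>;
    the second comes from \<open>bound\<close>.\<close>
  define \<kappa> where "\<kappa> = (3 + 2 * B * norm c) * sqrt (B / m)"
  have "\<kappa> \<ge> 0" using B c by (simp add: \<kappa>_def)
  moreover have "infdist y (squares_of jp W') \<le> \<kappa> * sqrt (norm y * (y \<bullet> z))" if y: "y \<in> ?K" for y
  proof -
    have "infdist y (squares_of jp W') \<le> dist y (y - 3 *\<^sub>R jp c y + 2 *\<^sub>R jp c (jp c y))"
      by (rule infdist_le[OF comp[OF y]])
    also have "\<dots> = norm (3 *\<^sub>R jp c y - 2 *\<^sub>R jp c (jp c y))"
      by (simp add: dist_norm algebra_simps)
    also have "\<dots> \<le> 3 * norm (jp c y) + 2 * norm (jp c (jp c y))"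
      using norm_triangle_ineq4[of "3 *\<^sub>R jp c y" "2 *\<^sub>R jp c (jp c y)"] by simp
    also have "\<dots> \<le> (3 + 2 * B * norm c) * norm (jp c y)"
      using B(2)[of c "jp c y"] by (simp add: algebra_simps)
    also have "\<dots> \<le> (3 + 2 * B * norm c) * sqrt (B * norm y * (y \<bullet> z) / m)"
      using B(1) real_le_rsqrt[OF bound[OF y]] by (intro mult_left_mono) auto
    also have "B * norm y * (y \<bullet> z) / m = (B / m) * (norm y * (y \<bullet> z))" by simp
    finally show ?thesis unfolding \<kappa>_def by (simp only: real_sqrt_mult mult.assoc)
  qed
  ultimately show thesis using that W'.jordan_subalgebra_axioms by blast
qed

text \<open>The step bound extends from the cone to points near it: the nearest point
  \<open>y\<close> of the cone has \<open>y \<bullet> z\<close> of order \<open>\<delta>\<close> and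
  norm at most \<open>norm x + \<delta>\<close>, and subadditivity of the square root separates the
  two contributions.\<close>

lemma facial_residual:
  assumes z: "z \<in> dual_cone (squares_of jp W)"
  obtains W' u' \<kappa> where "jordan_subalgebra jp e W' u'"
    "squares_of jp W \<inter> {z}\<^sup>\<bottom> = squares_of jp W'" "\<kappa> > 0"
    "\<And>x \<delta>. infdist x (squares_of jp W) \<le> \<delta> \<Longrightarrow> x \<bullet> z \<le> \<delta> \<Longrightarrow>
       infdist x (squares_of jp W') \<le> \<kappa> * (\<delta> + sqrt (\<delta> * norm x))"
proof -
  let ?K = "squares_of jp W"
  obtain W' u' \<kappa> where W': "jordan_subalgebra jp e W' u'" "?K \<inter> {z}\<^sup>\<bottom> = squares_of jp W'" "\<kappa> \<ge> 0"
    and res: "\<And>y. y \<in> ?K \<Longrightarrow> infdist y (squares_of jp W') \<le> \<kappa> * sqrt (norm y * (y \<bullet> z))"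
    by (rule facial_reduction_step[OF z]) (rule that)
  define C where "C = 1 + \<kappa> * sqrt (1 + norm z)"
  have C: "C \<ge> 1" "\<kappa> * sqrt (1 + norm z) \<le> C" using W'(3) by (simp_all add: C_def)
  have "infdist x (squares_of jp W') \<le> C * (\<delta> + sqrt (\<delta> * norm x))"
    if d: "infdist x ?K \<le> \<delta>" and xz: "x \<bullet> z \<le> \<delta>" for x \<delta>
  proof -
    have d0: "0 \<le> \<delta>" using d infdist_nonneg order_trans by blast
    obtain y where y: "y \<in> ?K" "infdist x ?K = dist x y"
      by (rule infdist_attains_inf[OF squares_closed convex_cone_nonempty[OF squares_convex_cone]])
         (rule that)
    then have xy: "norm (x - y) \<le> \<delta>" using d by (simp add: dist_norm)
    have "y \<bullet> z = x \<bullet> z + (y - x) \<bullet> z" by (simp add: inner_simps)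
    also have "(y - x) \<bullet> z \<le> \<delta> * norm z"
      using norm_cauchy_schwarz[of "y - x" z] mult_right_mono[OF xy norm_ge_zero[of z]]
      by (simp add: norm_minus_commute)
    finally have yz: "y \<bullet> z \<le> (1 + norm z) * \<delta>" using xz by (simp add: algebra_simps)
    have yz0: "0 \<le> y \<bullet> z" using z y by (simp add: dual_cone_def inner_commute)
    have ny: "norm y \<le> norm x + \<delta>"
      using norm_triangle_ineq2[of y x] xy by (simp add: norm_minus_commute)
    have "infdist y (squares_of jp W') \<le> \<kappa> * sqrt (norm y * (y \<bullet> z))" by (rule res[OF y(1)])
    also have "\<dots> \<le> \<kappa> * sqrt ((norm x + \<delta>) * ((1 + norm z) * \<delta>))"
      using W'(3) ny yz yz0 d0 by (intro mult_left_mono real_sqrt_le_mono mult_mono) auto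
    also have "(norm x + \<delta>) * ((1 + norm z) * \<delta>) = (1 + norm z) * (\<delta> * norm x + \<delta>\<^sup>2)"
      by (simp add: algebra_simps power2_eq_square)
    also have "\<kappa> * sqrt \<dots> = (\<kappa> * sqrt (1 + norm z)) * sqrt (\<delta> * norm x + \<delta>\<^sup>2)"
      by (simp add: real_sqrt_mult)
    also have "\<dots> \<le> (\<kappa> * sqrt (1 + norm z)) * (sqrt (\<delta> * norm x) + sqrt (\<delta>\<^sup>2))"
      using W'(3) d0 by (intro mult_left_mono sqrt_add_le_add_sqrt) auto
    finally have "infdist y (squares_of jp W') \<le> (\<kappa> * sqrt (1 + norm z)) * (sqrt (\<delta> * norm x) + \<delta>)"
      using d0 by simp
    moreover have "infdist x (squares_of jp W') \<le> infdist y (squares_of jp W') + \<delta>"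
      using infdist_triangle[of x "squares_of jp W'" y] xy by (simp add: dist_norm)
    moreover have "0 \<le> sqrt (\<delta> * norm x)" using d0 by simp
    ultimately show ?thesis unfolding C_def distrib_right mult_1 by (simp del: real_sqrt_ge_0_iff add: add.commute)
  qed
  then show thesis using that[of W' u' C] W' C(1) by simp
qed

end

section \<open>Error bounds for polyhedra\<close>

text \<open>A short step from \<open>p\<close> towards \<open>q\<close> stays in \<open>P\<close>;
  convexity of the distance to \<open>x\<close> then transfers minimality from that step to
  \<open>q\<close>.\<close>

lemma closest_point_superset:
  fixes P Q :: "'a::euclidean_space set"
  assumes Q: "convex Q" and PQ: "P \<subseteq> Q" and p: "p \<in> P"
    and min: "\<And>y. y \<in> P \<Longrightarrow> dist x p \<le> dist x y"
    and r: "r > 0" "Q \<inter> ball p r \<subseteq> P" and q: "q \<in> Q"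
  shows "dist x p \<le> dist x q"
proof (cases "q = p")
  case False
  define t where "t = min 1 (r / (2 * dist p q))"
  have d: "dist p q > 0" using False by simp
  have t: "0 < t" "t \<le> 1" "t * dist p q < r"
    using r(1) d by (auto simp: t_def min_def field_simps)
  define y where "y = (1 - t) *\<^sub>R p + t *\<^sub>R q"
  have "y \<in> Q" unfolding y_def using t p PQ q by (intro convexD[OF Q]) auto
  moreover have "dist p y = t * dist p q"
  proof -
    have "p - y = t *\<^sub>R (p - q)" by (simp add: y_def algebra_simps)
    then show ?thesis using t by (simp add: dist_norm)
  qed
  ultimately have "y \<in> P" using r(2) t by auto
  then have "dist x p \<le> dist x y" by (rule min)
  also have "x - y = (1 - t) *\<^sub>R (x - p) + t *\<^sub>R (x - q)"
    by (simp add: y_def algebra_simps)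
  then have "dist x y \<le> (1 - t) * dist x p + t * dist x q"
    using norm_triangle_ineq[of "(1 - t) *\<^sub>R (x - p)" "t *\<^sub>R (x - q)"] t by (simp add: dist_norm)
  finally have "t * dist x p \<le> t * dist x q" by (simp add: algebra_simps)
  then show ?thesis using t by simp
qed simp

text \<open>Constraints are kept as data, so that they can be counted and dropped one by one. Zero
  normals are allowed, as preimages under linear maps can produce them.\<close>

definition halfspaces :: "('a::real_inner \<times> real) set \<Rightarrow> 'a set" where
  "halfspaces I = {x. \<forall>(a, b)\<in>I. a \<bullet> x \<le> b}"

lemma closed_halfspaces: "closed (halfspaces I)"
proof -
  have "halfspaces I = (\<Inter>(a, b)\<in>I. {x. a \<bullet> x \<le> b})" by (auto simp: halfspaces_def)
  then show ?thesis by (auto intro!: closed_INT closed_halfspace_le)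
qed

lemma convex_halfspaces: "convex (halfspaces I)"
proof -
  have "halfspaces I = (\<Inter>(a, b)\<in>I. {x. a \<bullet> x \<le> b})" by (auto simp: halfspaces_def)
  then show ?thesis by (auto intro!: convex_INT convex_halfspace_le)
qed

text \<open>A vector of the polar cone that violates no constraint lies in the cone as well, so it
  is orthogonal to itself and zero. The total violation \<open>g\<close> is therefore positive on
  the compact set of unit vectors of the polar cone, and its minimum there gives the constant by
  scaling.\<close>

lemma hoffman_polar_cone:
  fixes A :: "'a::euclidean_space set"
  assumes A: "finite A"
  obtains H where "H > 0"
    "\<And>v r. (\<And>d. (\<forall>a\<in>A. a \<bullet> d \<le> 0) \<Longrightarrow> v \<bullet> d \<le> 0) \<Longrightarrow> 0 \<le> r \<Longrightarrow> (\<And>a. a \<in> A \<Longrightarrow> a \<bullet> v \<le> r) \<Longrightarrow> norm v \<le> H * r"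
proof -
  define N where "N = (\<Inter>d\<in>{d. \<forall>a\<in>A. a \<bullet> d \<le> 0}. {v. d \<bullet> v \<le> 0})"
  define S where "S = sphere 0 1 \<inter> N"
  define g where "g v = (\<Sum>a\<in>A. max 0 (a \<bullet> v))" for v
  have "compact S"
    unfolding S_def N_def by (intro compact_Int_closed closed_INT ballI closed_halfspace_le) simp
  have cont: "continuous_on S g"
    unfolding g_def by (intro continuous_intros)
  have pos: "g v > 0" if v: "v \<in> S" for v
  proof (rule ccontr)
    assume "\<not> g v > 0"
    moreover have "g v \<ge> 0" unfolding g_def by (intro sum_nonneg) simp
    ultimately have "g v = 0" by simp
    then have "\<forall>a\<in>A. max 0 (a \<bullet> v) = 0"
      unfolding g_def using A by (subst (asm) sum_nonneg_eq_0_iff) auto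
    then have "\<forall>a\<in>A. a \<bullet> v \<le> 0" by (metis max.cobounded2)
    then have "v \<bullet> v \<le> 0" using v by (simp add: S_def N_def)
    then have "v = 0" by (metis inner_gt_zero_iff not_less)
    then show False using v by (simp add: S_def)
  qed
  obtain m where m: "m > 0" "\<And>v. v \<in> S \<Longrightarrow> m \<le> g v"
  proof (cases "S = {}")
    case False
    then obtain w where "w \<in> S" "\<And>v. v \<in> S \<Longrightarrow> g w \<le> g v"
      using continuous_attains_inf[OF \<open>compact S\<close> _ cont] by blast
    then show thesis using pos by (intro that[of "g w"]) auto
  qed (use that[of 1] in auto)
  \<comment> \<open>The added 1 keeps the constant positive when \<open>A\<close> is empty.\<close>
  have main: "norm v \<le> (real (card A) + 1) / m * r"
    if v: "\<And>d. (\<forall>a\<in>A. a \<bullet> d \<le> 0) \<Longrightarrow> v \<bullet> d \<le> 0" and r: "0 \<le> r" "\<And>a. a \<in> A \<Longrightarrow> a \<bullet> v \<le> r" for v r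
  proof (cases "v = 0")
    case False
    have "v /\<^sub>R norm v \<in> S"
      using v False by (auto simp: S_def N_def inner_commute mult_le_0_iff)
    then have "m \<le> g (v /\<^sub>R norm v)" by (rule m(2))
    also have "\<dots> \<le> (\<Sum>a\<in>A. r / norm v)"
      unfolding g_def using r False
      by (intro sum_mono) (simp add: divide_inverse mult.commute mult_left_mono)
    finally have "m * norm v \<le> real (card A) * r"
      using False by (simp add: field_simps)
    also have "\<dots> \<le> (real (card A) + 1) * r" using r by (simp add: algebra_simps)
    finally show ?thesis using m(1) by (simp add: field_simps)
  qed (use r m in simp)
  show thesis
    by (rule that[of "(real (card A) + 1) / m"]) (use m main in auto)
qed

text \<open>Constraints inactive at the nearest point can be dropped, so by induction only the case of
  all constraints being active remains; there the problem is a conic one and compactness applies.\<close>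

lemma hoffman:
  fixes I :: "('a::euclidean_space \<times> real) set"
  assumes "finite I" "halfspaces I \<noteq> {}"
  obtains H where "H > 0"
    "\<And>x r. 0 \<le> r \<Longrightarrow> (\<And>a b. (a, b) \<in> I \<Longrightarrow> a \<bullet> x - b \<le> r) \<Longrightarrow> infdist x (halfspaces I) \<le> H * r"
proof -
  have "\<exists>H>0. \<forall>x r. 0 \<le> r \<longrightarrow> (\<forall>(a, b)\<in>I. a \<bullet> x - b \<le> r) \<longrightarrow> infdist x (halfspaces I) \<le> H * r"
    using assms
  proof (induction "card I" arbitrary: I rule: less_induct)
    case less
    note fin = less.prems(1)
    have "\<forall>i\<in>I. \<exists>H>0. \<forall>x r. 0 \<le> r \<longrightarrow> (\<forall>(a, b)\<in>I - {i}. a \<bullet> x - b \<le> r) \<longrightarrow>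
        infdist x (halfspaces (I - {i})) \<le> H * r"
    proof
      fix i assume i: "i \<in> I"
      have "halfspaces (I - {i}) \<noteq> {}" using less.prems(2) by (auto simp: halfspaces_def)
      then show "\<exists>H>0. \<forall>x r. 0 \<le> r \<longrightarrow> (\<forall>(a, b)\<in>I - {i}. a \<bullet> x - b \<le> r) \<longrightarrow>
        infdist x (halfspaces (I - {i})) \<le> H * r"
        using fin i by (intro less.hyps) (auto simp del: card_Diff_singleton card_Diff_insert intro: card_Diff1_less)
    qed
    then obtain h where h: "\<And>i. i \<in> I \<Longrightarrow> h i > 0"
      "\<And>i x r. i \<in> I \<Longrightarrow> 0 \<le> r \<Longrightarrow> (\<forall>(a, b)\<in>I - {i}. a \<bullet> x - b \<le> r) \<Longrightarrow>
        infdist x (halfspaces (I - {i})) \<le> h i * r"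
      by metis
    obtain H where H: "H > 0"
      "\<And>v r. (\<And>d. (\<forall>a\<in>fst ` I. a \<bullet> d \<le> 0) \<Longrightarrow> v \<bullet> d \<le> 0) \<Longrightarrow> 0 \<le> r \<Longrightarrow> (\<And>a. a \<in> fst ` I \<Longrightarrow> a \<bullet> v \<le> r) \<Longrightarrow> norm v \<le> H * r"
      by (rule hoffman_polar_cone[of "fst ` I"]) (use fin in auto)
    define H' where "H' = H + (\<Sum>i\<in>I. h i)"
    have hH': "h i \<le> H'" if "i \<in> I" for i
      using member_le_sum[OF that _ fin, of h] h(1) H(1) by (force simp: H'_def less_imp_le)
    have HH': "H \<le> H'" using h(1) by (auto simp: H'_def less_imp_le intro: sum_nonneg)
    have "infdist x (halfspaces I) \<le> H' * r" if r: "0 \<le> r" and viol: "\<forall>(a, b)\<in>I. a \<bullet> x - b \<le> r" for x r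
    proof -
      obtain p where p: "p \<in> halfspaces I" "infdist x (halfspaces I) = dist x p"
        by (rule infdist_attains_inf[OF closed_halfspaces less.prems(2)]) (rule that)
      have min: "dist x p \<le> dist x y" if "y \<in> halfspaces I" for y
        using infdist_le[OF that, of x] p by simp
      show ?thesis
      proof (cases "\<exists>(a, b)\<in>I. a \<bullet> p < b")
        case True
        then obtain a b where ab: "(a, b) \<in> I" "a \<bullet> p < b" by blast
        have "open {y. a \<bullet> y < b}" by (rule open_halfspace_lt)
        then obtain s where s: "s > 0" "ball p s \<subseteq> {y. a \<bullet> y < b}"
          using ab(2) open_contains_ball by (metis mem_Collect_eq)
        have *: "dist x p \<le> dist x q" if "q \<in> halfspaces (I - {(a, b)})" for q
        proof (rule closest_point_superset[OF convex_halfspaces[of "I - {(a, b)}"] _ p(1) min s(1) _ that])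
          show "halfspaces I \<subseteq> halfspaces (I - {(a, b)})" by (auto simp: halfspaces_def)
          show "halfspaces (I - {(a, b)}) \<inter> ball p s \<subseteq> halfspaces I"
          proof
            fix y assume y: "y \<in> halfspaces (I - {(a, b)}) \<inter> ball p s"
            then have "a \<bullet> y < b" using s(2) by blast
            then show "y \<in> halfspaces I" using y by (fastforce simp: halfspaces_def)
          qed
        qed
        have "dist x p \<le> infdist x (halfspaces (I - {(a, b)}))"
        proof -
          have "halfspaces (I - {(a, b)}) \<noteq> {}" using p(1) by (auto simp: halfspaces_def)
          then show ?thesis unfolding infdist_notempty[OF \<open>halfspaces (I - {(a, b)}) \<noteq> {}\<close>]
            by (rule cINF_greatest) (rule *)
        qed
        also have "\<dots> \<le> h (a, b) * r" using viol by (intro h(2) ab(1) r) auto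
        also have "\<dots> \<le> H' * r" using hH'[OF ab(1)] r by (rule mult_right_mono)
        finally show ?thesis using p(2) by simp
      next
        case False
        then have act: "a \<bullet> p = b" if "(a, b) \<in> I" for a b
          using that p(1) by (force simp: halfspaces_def)
        have "norm (x - p) \<le> H * r"
        proof (rule H(2)[OF _ r])
          \<comment> \<open>Since all constraints are active at \<open>p\<close>, moving along
            \<open>d\<close> stays feasible, and the obtuse-angle property of the nearest point puts
            \<open>x - p\<close> in the polar cone.\<close>
          fix d assume d: "\<forall>a\<in>fst ` I. a \<bullet> d \<le> 0"
          have "p + d \<in> halfspaces I"
            using d act by (force simp: halfspaces_def inner_add_right)
          then show "(x - p) \<bullet> d \<le> 0"
            using any_closest_point_dot[OF convex_halfspaces closed_halfspaces p(1), of "p + d" x] min by simp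
        next
          fix a assume "a \<in> fst ` I"
          then obtain b where "(a, b) \<in> I" by auto
          then show "a \<bullet> (x - p) \<le> r" using viol act[of a b] by (auto simp: inner_diff_right)
        qed
        also have "\<dots> \<le> H' * r" using HH' r by (rule mult_right_mono)
        finally show ?thesis using p(2) by (simp add: dist_norm)
      qed
    qed
    moreover have "H' > 0" using H(1) HH' by simp
    ultimately show ?case by blast
  qed
  then show thesis using that by (force simp: split_beta)
qed

section \<open>From Hoffman's bound to pairs of polyhedra\<close>

lemma polyhedron_halfspaces:
  assumes "polyhedron S"
  obtains I where "finite I" "S = halfspaces I"
proof -
  obtain F where F: "finite F" "S = \<Inter>F" "\<forall>h\<in>F. \<exists>a b. a \<noteq> 0 \<and> h = {x. a \<bullet> x \<le> b}"
    using assms unfolding polyhedron_def by blast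
  then obtain f g where fg: "\<And>h. h \<in> F \<Longrightarrow> h = {x. f h \<bullet> x \<le> g h}" by metis
  have "S = halfspaces ((\<lambda>h. (f h, g h)) ` F)"
    unfolding F(2) using fg by (auto simp: halfspaces_def)
  then show thesis using that F(1) by blast
qed

lemma halfspaces_polyhedron:
  assumes "finite I"
  shows "polyhedron (halfspaces (I :: ('a::euclidean_space \<times> real) set))"
proof -
  have "halfspaces I = \<Inter>((\<lambda>(a, b). {x. a \<bullet> x \<le> b}) ` I)" by (auto simp: halfspaces_def)
  then show ?thesis using assms by (auto simp: polyhedron_halfspace_le)
qed

lemma polyhedron_linear_vimage:
  fixes f :: "'a::euclidean_space \<Rightarrow> 'b::euclidean_space"
  assumes "linear f" "polyhedron S"
  shows "polyhedron (f -` S)"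
proof -
  obtain I where I: "finite I" "S = halfspaces I" by (rule polyhedron_halfspaces[OF assms(2)])
  have "f -` S = halfspaces ((\<lambda>(a, b). (adjoint f a, b)) ` I)"
    unfolding I(2) by (force simp: halfspaces_def adjoint_works[OF assms(1)] inner_commute)
  then show ?thesis using I(1) by (simp add: halfspaces_polyhedron)
qed

text \<open>Hoffman's bound for the union of both systems: a point within \<open>\<epsilon>\<close>
  of a polyhedron violates each of its constraints by at most \<open>\<epsilon>\<close> times the
  norm of the normal.\<close>

lemma polyhedra_linear_regularity:
  fixes P Q :: "'a::euclidean_space set"
  assumes P: "polyhedron P" and Q: "polyhedron Q" and ne: "P \<inter> Q \<noteq> {}"
  obtains H where "H > 0"
    "\<And>x \<epsilon>. infdist x P \<le> \<epsilon> \<Longrightarrow> infdist x Q \<le> \<epsilon> \<Longrightarrow> infdist x (P \<inter> Q) \<le> H * \<epsilon>"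
proof -
  obtain I where I: "finite I" "P = halfspaces I" by (rule polyhedron_halfspaces[OF P])
  obtain J where J: "finite J" "Q = halfspaces J" by (rule polyhedron_halfspaces[OF Q])
  have PQ: "P \<inter> Q = halfspaces (I \<union> J)" unfolding I J by (auto simp: halfspaces_def)
  obtain H where H: "H > 0"
    "\<And>x r. 0 \<le> r \<Longrightarrow> (\<And>a b. (a, b) \<in> I \<union> J \<Longrightarrow> a \<bullet> x - b \<le> r) \<Longrightarrow> infdist x (P \<inter> Q) \<le> H * r"
    by (rule hoffman[of "I \<union> J"]) (use I(1) J(1) ne PQ in auto)
  define M where "M = 1 + (\<Sum>(a, b)\<in>I \<union> J. norm a)"
  have M: "norm a \<le> M" if "(a, b) \<in> I \<union> J" for a b
    using member_le_sum[OF that, of "\<lambda>(a, b). norm a"] I(1) J(1) by (simp add: M_def split_beta)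
  have "M \<ge> 1" by (auto simp: M_def intro!: sum_nonneg)
  have viol: "a \<bullet> x - b \<le> M * \<epsilon>"
    if d: "infdist x (halfspaces K) \<le> \<epsilon>" and ne: "halfspaces K \<noteq> {}" and ab: "(a, b) \<in> K" "K \<subseteq> I \<union> J"
    for x \<epsilon> a b K
  proof -
    obtain p where p: "p \<in> halfspaces K" "infdist x (halfspaces K) = dist x p"
      by (rule infdist_attains_inf[OF closed_halfspaces ne]) (rule that)
    have "a \<bullet> p \<le> b" using p(1) ab by (auto simp: halfspaces_def)
    then have "a \<bullet> x - b \<le> a \<bullet> (x - p)" by (simp add: inner_diff_right)
    also have "\<dots> \<le> norm a * norm (x - p)" by (rule norm_cauchy_schwarz)
    also have "\<dots> \<le> M * \<epsilon>"
      using M[of a b] ab p(2) d \<open>M \<ge> 1\<close> by (intro mult_mono) (auto simp: dist_norm intro: order_trans)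
    finally show ?thesis .
  qed
  have "infdist x (P \<inter> Q) \<le> (H * M) * \<epsilon>" if "infdist x P \<le> \<epsilon>" "infdist x Q \<le> \<epsilon>" for x \<epsilon>
  proof -
    have "0 \<le> \<epsilon>" using that(1) infdist_nonneg order_trans by blast
    then have "infdist x (P \<inter> Q) \<le> H * (M * \<epsilon>)"
      using \<open>M \<ge> 1\<close> that viol[of x I \<epsilon>] viol[of x J \<epsilon>] ne
      by (intro H(2)) (auto simp: I(2)[symmetric] J(2)[symmetric])
    then show ?thesis by simp
  qed
  moreover have "H * M > 0" using H(1) \<open>M \<ge> 1\<close> by simp
  ultimately show thesis using that by blast
qed

section \<open>The partial polyhedral Slater condition\<close>

lemma affine_translate_affine:
  assumes "subspace L"
  shows "affine (affine_translate L a)"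
proof -
  have "affine_translate L a = (+) a ` L" by (auto simp: affine_translate_def add.commute)
  then show ?thesis using assms by (simp add: subspace_imp_affine affine_translation[symmetric])
qed

text \<open>Since \<open>C1\<close> is solid in its span, a point of the polyhedron \<open>(span C1 + C2) \<inter> M\<close> close to
  \<open>C1 + C2\<close> is brought into it by moving slightly towards a Slater point; nearby points of the
  polyhedron come from Hoffman's bound.\<close>

lemma PPS_error_bound:
  fixes C L :: "'a::euclidean_space set"
  assumes L: "subspace L" and PPS: "PPS C L a"
  obtains \<kappa> where "\<kappa> > 0"
    "\<And>x \<epsilon>. infdist x C \<le> \<epsilon> \<Longrightarrow> infdist x (affine_translate L a) \<le> \<epsilon> \<Longrightarrow>
       infdist x (affine_translate L a \<inter> C) \<le> (\<kappa> * norm x + \<kappa>) * \<epsilon>"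
proof -
  define M where "M = affine_translate L a"
  obtain E1 C1 C2 x1 x2 where E1: "subspace E1" and sub: "C1 \<subseteq> E1" "C2 \<subseteq> E1\<^sup>\<bottom>"
    and C1: "closed C1" "convex_cone C1" and C2: "closed C2" "convex_cone C2" "polyhedron C2"
    and C: "C = C1 + C2" and x: "x1 \<in> rel_interior C1" "x2 \<in> C2" "x1 + x2 \<in> M"
    using PPS unfolding PPS_def M_def by blast
  have affM: "affine M" unfolding M_def by (rule affine_translate_affine[OF L])
  \<comment> \<open>\<open>\<pi>\<close> is the orthogonal projection onto
    \<open>E1\<close>.\<close>
  define \<pi> where "\<pi> x = (THE p. p \<in> E1 \<and> x - p \<in> E1\<^sup>\<bottom>)" for x
  have uniq: "p = q" if "p \<in> E1" "x - p \<in> E1\<^sup>\<bottom>" "q \<in> E1" "x - q \<in> E1\<^sup>\<bottom>" for x p q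
  proof -
    have "p - q \<in> E1" using that E1 by (blast intro: subspace_diff)
    moreover have "(x - q) - (x - p) \<in> E1\<^sup>\<bottom>"
      using that subspace_orthogonal_comp by (blast intro: subspace_diff)
    then have "p - q \<in> E1\<^sup>\<bottom>" by simp
    ultimately have "(p - q) \<bullet> (p - q) = 0" by (simp add: orthogonal_comp_def orthogonal_def)
    then show ?thesis by simp
  qed
  have ex: "\<exists>p. p \<in> E1 \<and> x - p \<in> E1\<^sup>\<bottom>" for x
  proof -
    obtain p q where "p \<in> span E1" "\<And>w. w \<in> span E1 \<Longrightarrow> orthogonal q w" "x = p + q"
      by (rule orthogonal_subspace_decomp_exists[of E1 x]) (rule that)
    then show ?thesis using E1
      by (intro exI[of _ p]) (auto simp: orthogonal_comp_def orthogonal_commute span_eq_iff[THEN iffD2])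
  qed
  have \<pi>: "\<pi> x \<in> E1" "x - \<pi> x \<in> E1\<^sup>\<bottom>" for x
    using theI'[of "\<lambda>p. p \<in> E1 \<and> x - p \<in> E1\<^sup>\<bottom>"] ex[of x] uniq[of _ x] unfolding \<pi>_def by blast+
  have \<pi>_eq: "\<pi> x = p" if "p \<in> E1" "x - p \<in> E1\<^sup>\<bottom>" for x p
    using uniq \<pi> that by blast
  have lin: "linear \<pi>"
  proof
    fix x y :: 'a and c :: real
    have "x + y - (\<pi> x + \<pi> y) = (x - \<pi> x) + (y - \<pi> y)" by simp
    also have "\<dots> \<in> E1\<^sup>\<bottom>" by (intro subspace_add subspace_orthogonal_comp \<pi>)
    finally show "\<pi> (x + y) = \<pi> x + \<pi> y"
      by (intro \<pi>_eq subspace_add E1 \<pi>)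
    have "c *\<^sub>R x - c *\<^sub>R \<pi> x = c *\<^sub>R (x - \<pi> x)" by (simp add: scaleR_diff_right)
    also have "\<dots> \<in> E1\<^sup>\<bottom>" by (intro subspace_scale subspace_orthogonal_comp \<pi>)
    finally show "\<pi> (c *\<^sub>R x) = c *\<^sub>R \<pi> x"
      by (intro \<pi>_eq subspace_scale E1 \<pi>)
  qed
  have \<pi>_contr: "norm (\<pi> x) \<le> norm x" for x
  proof -
    have "\<pi> x \<bullet> (x - \<pi> x) = 0"
      using \<pi> by (auto simp: orthogonal_comp_def orthogonal_def)
    then have "norm (\<pi> x) * norm (\<pi> x) = \<pi> x \<bullet> x"
      by (simp add: inner_diff_right dot_square_norm power2_eq_square)
    also have "\<dots> \<le> norm (\<pi> x) * norm x" by (rule norm_cauchy_schwarz)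
    finally show ?thesis by (cases "\<pi> x = 0") simp_all
  qed
  \<comment> \<open>Relaxing \<open>C1\<close> to its span gives a polyhedron around
    \<open>C\<close>, so that only membership of the \<open>E1\<close>-part in \<open>C1\<close> has
    to be repaired.\<close>
  define P where "P = \<pi> -` span C1 \<inter> (\<lambda>x. x - \<pi> x) -` C2"
  have "polyhedron P"
    unfolding P_def
    by (intro polyhedron_Int polyhedron_linear_vimage lin linear_compose_sub linear_id[unfolded id_def]
        C2(3) affine_imp_polyhedron[OF subspace_imp_affine[OF subspace_span]])
  have sum: "\<pi> (c1 + c2) = c1" if "c1 \<in> C1" "c2 \<in> C2" for c1 c2
    using that sub by (intro \<pi>_eq) auto
  have CP: "C \<subseteq> P"
    unfolding C P_def using sum by (auto elim!: set_plus_elim simp: span_base)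
  have x1: "x1 \<in> C1" using x(1) rel_interior_subset by blast
  define x0 where "x0 = x1 + x2"
  have x0: "x0 \<in> P \<inter> M" "x0 \<in> C"
    using x x1 CP by (auto simp: x0_def C)
  obtain H where H: "H > 0"
    "\<And>x \<epsilon>. infdist x P \<le> \<epsilon> \<Longrightarrow> infdist x M \<le> \<epsilon> \<Longrightarrow> infdist x (P \<inter> M) \<le> H * \<epsilon>"
    by (rule polyhedra_linear_regularity[OF \<open>polyhedron P\<close> affine_imp_polyhedron[OF affM]])
       (use x0 in auto)
  have "affine hull C1 = span C1"
    using C1(2) by (intro affine_hull_span_0 hull_inc convex_cone_contains_0)
  then obtain r where r: "r > 0" "\<And>y. y \<in> span C1 \<Longrightarrow> norm (y - x1) \<le> r \<Longrightarrow> y \<in> C1"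
    using x(1) unfolding mem_rel_interior_cball by (auto simp: dist_norm norm_minus_commute subset_iff)
  have ne: "C \<noteq> {}" "M \<inter> C \<noteq> {}" "P \<inter> M \<noteq> {}" using x0 by auto
  have closedPM: "closed (P \<inter> M)"
    using \<open>polyhedron P\<close> affM by (intro closed_Int polyhedron_imp_closed affine_closed)
  \<comment> \<open>\<open>D * \<epsilon>\<close> will bound the distance from
    \<open>\<pi> p\<close> to \<open>C1\<close>: \<open>\<epsilon>\<close> from \<open>x\<close> to
    \<open>C\<close> plus \<open>H * \<epsilon>\<close> from \<open>x\<close> to
    \<open>p\<close>.\<close>
  define D where "D = H + 1"
  define \<kappa> where "\<kappa> = D / r + H + D * norm x0 / r"
  have \<kappa>: "\<kappa> > 0" "D / r \<le> \<kappa>" "H + D * norm x0 / r \<le> \<kappa>"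
    using H(1) r(1) by (simp_all add: \<kappa>_def D_def add_pos_nonneg)
  have "infdist x (M \<inter> C) \<le> (\<kappa> * norm x + \<kappa>) * \<epsilon>"
    if d: "infdist x C \<le> \<epsilon>" "infdist x M \<le> \<epsilon>" for x \<epsilon>
  proof -
    have \<epsilon>: "0 \<le> \<epsilon>" using d(1) infdist_nonneg order_trans by blast
    have "infdist x P \<le> \<epsilon>" using infdist_mono[OF CP ne(1)] d(1) by (rule order_trans)
    then have "infdist x (P \<inter> M) \<le> H * \<epsilon>" using H(2) d(2) by blast
    then obtain p where p: "p \<in> P" "p \<in> M" "norm (x - p) \<le> H * \<epsilon>"
      using infdist_attains_inf[OF closedPM ne(3), of x] by (metis Int_iff dist_norm)
    define \<delta> where "\<delta> = D * \<epsilon>"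
    have \<delta>: "\<delta> \<ge> 0" using \<epsilon> H(1) by (simp add: \<delta>_def D_def)
    obtain q where q: "q \<in> C1" "infdist (\<pi> p) C1 = dist (\<pi> p) q"
      by (rule infdist_attains_inf[OF C1(1) convex_cone_nonempty[OF C1(2)]]) (rule that)
    have "infdist (\<pi> p) C1 \<le> infdist p C"
      unfolding infdist_notempty[OF ne(1)]
    proof (rule cINF_greatest[OF ne(1)])
      fix y assume "y \<in> C"
      then obtain c1 c2 where y: "c1 \<in> C1" "c2 \<in> C2" "y = c1 + c2"
        unfolding C by (auto elim: set_plus_elim)
      have "infdist (\<pi> p) C1 \<le> dist (\<pi> p) c1" by (rule infdist_le[OF y(1)])
      also have "\<dots> = norm (\<pi> (p - y))"
        using sum[OF y(1,2)] by (simp add: linear_diff[OF lin] y(3) dist_norm)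
      also have "\<dots> \<le> dist p y" unfolding dist_norm by (rule \<pi>_contr)
      finally show "infdist (\<pi> p) C1 \<le> dist p y" .
    qed
    also have "\<dots> \<le> infdist x C + dist p x" by (rule infdist_triangle)
    also have "\<dots> \<le> \<epsilon> + H * \<epsilon>"
      using d(1) p(3) by (intro add_mono) (simp_all add: dist_norm norm_minus_commute)
    also have "\<dots> = \<delta>" by (simp add: \<delta>_def D_def algebra_simps)
    finally have dq: "norm (\<pi> p - q) \<le> \<delta>" using q(2) by (simp add: dist_norm)
    \<comment> \<open>\<open>t\<close> is balanced so that the defect
      \<open>(1 - t) *\<^sub>R (\<pi> p - q)\<close> equals \<open>t *\<^sub>R w\<close> with
      \<open>norm w \<le> r\<close>, which the ball around \<open>x1\<close> absorbs. For
      \<open>\<delta> = 0\<close> division by zero yields \<open>w = 0\<close>, in accordance with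
      \<open>\<pi> p = q\<close>.\<close>
    define t where "t = \<delta> / (\<delta> + r)"
    have t: "0 \<le> t" "t \<le> 1" "t \<le> \<delta> / r" and t1: "1 - t = r / (\<delta> + r)"
      using \<delta> r(1) by (simp_all add: t_def field_simps)
    define w where "w = (r / \<delta>) *\<^sub>R (\<pi> p - q)"
    have tw: "t *\<^sub>R w = (1 - t) *\<^sub>R (\<pi> p - q)"
      unfolding t1 using dq r(1) by (cases "\<delta> = 0") (simp_all add: w_def t_def)
    have "norm w \<le> r"
      using mult_left_mono[OF dq, of "r / \<delta>"] \<delta> r(1) by (cases "\<delta> = 0") (simp_all add: w_def)
    moreover have "x1 + w \<in> span C1"
      unfolding w_def using p(1) span_base[OF q(1)] span_base[OF x1]
      by (intro span_add span_scale span_diff) (auto simp: P_def)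
    ultimately have "x1 + w \<in> C1" using r(2)[of "x1 + w"] by simp
    then have "(1 - t) *\<^sub>R q + t *\<^sub>R (x1 + w) \<in> C1"
      using C1(2) q(1) t by (intro convexD) (auto simp: convex_cone_def)
    moreover have "(1 - t) *\<^sub>R q + t *\<^sub>R (x1 + w) = (1 - t) *\<^sub>R \<pi> p + t *\<^sub>R x1"
      by (simp add: scaleR_add_right tw scaleR_diff_right)
    ultimately have m1: "(1 - t) *\<^sub>R \<pi> p + t *\<^sub>R x1 \<in> C1" by simp
    have "(1 - t) *\<^sub>R (p - \<pi> p) + t *\<^sub>R x2 \<in> C2"
      using C2(2) p(1) x(2) t by (intro convexD) (auto simp: convex_cone_def P_def)
    then have "((1 - t) *\<^sub>R \<pi> p + t *\<^sub>R x1) + ((1 - t) *\<^sub>R (p - \<pi> p) + t *\<^sub>R x2) \<in> C"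
      unfolding C by (rule set_plus_intro[OF m1])
    moreover define y where "y = (1 - t) *\<^sub>R p + t *\<^sub>R x0"
    moreover have "((1 - t) *\<^sub>R \<pi> p + t *\<^sub>R x1) + ((1 - t) *\<^sub>R (p - \<pi> p) + t *\<^sub>R x2) = y"
      by (simp add: y_def x0_def algebra_simps)
    ultimately have "y \<in> C" by simp
    moreover have "y \<in> M"
      unfolding y_def using affM p(2) x0(1) by (intro mem_affine) auto
    ultimately have "infdist x (M \<inter> C) \<le> dist x y" by (intro infdist_le) simp
    also have "x - y = (1 - t) *\<^sub>R (x - p) + t *\<^sub>R (x - x0)"
      by (simp add: y_def algebra_simps)
    then have "dist x y \<le> (1 - t) * norm (x - p) + t * norm (x - x0)"
      using norm_triangle_ineq[of "(1 - t) *\<^sub>R (x - p)" "t *\<^sub>R (x - x0)"] t by (simp add: dist_norm)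
    also have "\<dots> \<le> 1 * (H * \<epsilon>) + (\<delta> / r) * (norm x + norm x0)"
      using t \<delta> r(1) p(3) by (intro add_mono mult_mono norm_triangle_ineq4) auto
    also have "\<dots> = ((D / r) * norm x + (H + D * norm x0 / r)) * \<epsilon>"
      by (simp add: \<delta>_def algebra_simps add_divide_distrib)
    also have "\<dots> \<le> (\<kappa> * norm x + \<kappa>) * \<epsilon>"
      using \<kappa> \<epsilon> by (intro mult_right_mono add_mono) auto
    finally show ?thesis .
  qed
  then show thesis using that \<kappa>(1) unfolding M_def by blast
qed

section \<open>Existence of a facial reduction chain\<close>

lemma PPS_Slater:
  fixes C L :: "'a::euclidean_space set"
  assumes "closed C" "convex_cone C" "rel_interior C \<inter> affine_translate L a \<noteq> {}"
  shows "PPS C L a"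
proof -
  obtain x where "x \<in> rel_interior C" "x \<in> affine_translate L a" using assms(3) by blast
  then show ?thesis
    unfolding PPS_def using assms(1,2)
    by (intro exI[of _ UNIV] exI[of _ "UNIV\<^sup>\<bottom>"] exI[of _ C] exI[of _ "{0}"])
       (auto simp: convex_cone_iff set_plus_def affine_imp_polyhedron)
qed

text \<open>Without a Slater point, \<open>a\<close> lies in \<open>C + L\<close> but outside its
  relative interior \<open>rel_interior C + L\<close>, so a supporting hyperplane passes through it.
  Homogeneity makes its normal nonnegative on \<open>C\<close> and zero on \<open>L\<close>,
  feasibility makes it orthogonal to \<open>a\<close>, and strictness on the relative interior keeps
  \<open>C\<close> from lying in the hyperplane.\<close>

lemma facial_reduction_direction:
  fixes C L :: "'a::euclidean_space set"
  assumes C: "convex_cone C" and L: "subspace L"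
    and feas: "C \<inter> affine_translate L a \<noteq> {}"
    and no_Slater: "rel_interior C \<inter> affine_translate L a = {}"
  obtains z where "z \<in> dual_cone C \<inter> L\<^sup>\<bottom> \<inter> {a}\<^sup>\<bottom>" "\<not> C \<subseteq> {z}\<^sup>\<bottom>"
proof -
  have conv: "convex C" "convex L" using C L by (auto simp: convex_cone_def subspace_imp_convex)
  have C0: "0 \<in> C" and L0: "0 \<in> L" using C L by (auto simp: convex_cone_contains_0 subspace_0)
  have ri: "rel_interior (C + L) = rel_interior C + L"
    using rel_interior_sum[OF conv] L by (simp add: rel_interior_affine subspace_imp_affine)
  obtain l where l: "l \<in> L" "l + a \<in> C" using feas by (auto simp: affine_translate_def)
  have "l + a + - l \<in> C + L" using l L by (intro set_plus_intro) (auto simp: subspace_neg)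
  then have aCL: "a \<in> C + L" by simp
  have a_notin: "a \<notin> rel_interior (C + L)"
  proof
    assume "a \<in> rel_interior (C + L)"
    then obtain c m where cm: "c \<in> rel_interior C" "m \<in> L" "a = c + m"
      unfolding ri by (auto elim: set_plus_elim)
    have "c = - m + a" using cm(3) by simp
    then have "c \<in> affine_translate L a"
      unfolding affine_translate_def by (rule image_eqI) (rule subspace_neg[OF L cm(2)])
    then show False using no_Slater cm(1) by blast
  qed
  obtain z where z: "\<And>y. y \<in> C + L \<Longrightarrow> z \<bullet> a \<le> z \<bullet> y"
      "\<And>y. y \<in> rel_interior (C + L) \<Longrightarrow> z \<bullet> a < z \<bullet> y"
    by (rule supporting_hyperplane_rel_boundary[OF convex_set_plus[OF conv] aCL a_notin]) (rule that)
  have nonneg: "0 \<le> z \<bullet> y" if y: "\<And>t. t \<ge> 0 \<Longrightarrow> t *\<^sub>R y \<in> C + L" for y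
  proof (rule ccontr)
    assume "\<not> 0 \<le> z \<bullet> y"
    then have neg: "z \<bullet> y < 0" by simp
    \<comment> \<open>Far enough along a ray with negative slope, \<open>z\<close> would fall below
      \<open>z \<bullet> a\<close>.\<close>
    define t where "t = (\<bar>z \<bullet> a\<bar> + 1) / - (z \<bullet> y)"
    have "z \<bullet> a \<le> z \<bullet> (t *\<^sub>R y)" using neg by (intro z(1) y) (simp add: t_def divide_le_0_iff)
    also have "\<dots> = - (\<bar>z \<bullet> a\<bar> + 1)" using neg by (simp add: t_def)
    finally show False by simp
  qed
  have dual: "0 \<le> z \<bullet> c" if "c \<in> C" for c
    using set_plus_intro[OF convex_cone_scaleR[OF C _ that] L0] by (intro nonneg) simp
  have nonneg_L: "0 \<le> z \<bullet> m" if "m \<in> L" for m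
    using set_plus_intro[OF C0 subspace_scale[OF L that]] by (intro nonneg) simp
  have perp: "z \<bullet> m = 0" if "m \<in> L" for m
    using nonneg_L[OF that] nonneg_L[OF subspace_neg[OF L that]] by simp
  have "z \<bullet> a \<le> 0" using z(1)[OF set_plus_intro[OF C0 L0]] by simp
  moreover have "0 \<le> z \<bullet> a" using dual[OF l(2)] perp[OF l(1)] by (simp add: inner_add_right)
  ultimately have za: "z \<bullet> a = 0" by simp
  obtain y where y: "y \<in> rel_interior C"
    using rel_interior_eq_empty[OF conv(1)] C0 by blast
  then have "z \<bullet> y > 0" using z(2)[of "y + 0"] set_plus_intro[OF y L0] za unfolding ri by simp
  moreover have "y \<in> C" using y rel_interior_subset by blast
  ultimately have "\<not> C \<subseteq> {z}\<^sup>\<bottom>" by (auto simp: orthogonal_comp_def orthogonal_def)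
  moreover have "z \<in> dual_cone C \<inter> L\<^sup>\<bottom> \<inter> {a}\<^sup>\<bottom>"
    using dual perp za by (auto simp: dual_cone_def orthogonal_comp_def orthogonal_def inner_commute)
  ultimately show thesis using that by blast
qed

lemma closed_orthogonal_comp: "closed (S\<^sup>\<bottom> :: 'a::euclidean_space set)"
  by (intro closed_subspace subspace_orthogonal_comp)

text \<open>Every direction found above cuts down the dimension, so Slater's condition, a special
  case of \<open>PPS\<close>, is reached eventually. Hence the \<open>LEAST\<close> in
  \<open>d_PPS\<close> is attained.\<close>

lemma facial_reduction_terminates:
  fixes K L :: "'a::euclidean_space set"
  assumes "closed K" "convex_cone K" and L: "subspace L" and "K \<inter> affine_translate L a \<noteq> {}"
  shows "\<exists>k (F :: nat \<Rightarrow> 'a set) z. F 1 = K \<and>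
    (\<forall>i\<in>{1..k}. z i \<in> dual_cone (F i) \<inter> L\<^sup>\<bottom> \<inter> {a}\<^sup>\<bottom> \<and> F (i + 1) = F i \<inter> {z i}\<^sup>\<bottom>) \<and> PPS (F (k + 1)) L a"
  using assms(1,2,4)
proof (induction "dim K" arbitrary: K rule: less_induct)
  case less
  show ?case
  proof (cases "rel_interior K \<inter> affine_translate L a = {}")
    case False
    then have "PPS K L a" using less.prems by (intro PPS_Slater)
    then show ?thesis by (intro exI[of _ 0] exI[of _ "\<lambda>_. K"] exI[of _ "\<lambda>_. 0"]) simp
  next
    case True
    obtain w where w: "w \<in> dual_cone K \<inter> L\<^sup>\<bottom> \<inter> {a}\<^sup>\<bottom>" "\<not> K \<subseteq> {w}\<^sup>\<bottom>"
      by (rule facial_reduction_direction[OF less.prems(2) L less.prems(3) True]) (rule that)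
    let ?K = "K \<inter> {w}\<^sup>\<bottom>"
    have dim: "dim ?K < dim K"
    proof (rule ccontr)
      assume "\<not> dim ?K < dim K"
      then have "span ?K = span K" by (intro dim_eq_span) auto
      moreover have "span ?K \<subseteq> {w}\<^sup>\<bottom>" by (intro span_minimal subspace_orthogonal_comp) auto
      ultimately show False using w(2) span_superset by blast
    qed
    have cl: "closed ?K" using less.prems(1) by (intro closed_Int closed_orthogonal_comp)
    have cone: "convex_cone ?K"
      using less.prems(2) subspace_orthogonal_comp[of "{w}"] by (auto simp: convex_cone_iff subspace_def)
    \<comment> \<open>Feasible points survive because \<open>w\<close> is orthogonal to
      \<open>L\<close> and \<open>a\<close>.\<close>
    have ne: "?K \<inter> affine_translate L a \<noteq> {}"
    proof -
      obtain x where x: "x \<in> K" "x \<in> affine_translate L a" using less.prems(3) by blast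
      then have "x \<in> {w}\<^sup>\<bottom>"
        using w(1) by (auto simp: affine_translate_def orthogonal_comp_def orthogonal_def inner_simps inner_commute)
      then show ?thesis using x by blast
    qed
    from less.hyps[OF dim cl cone ne] obtain k :: nat and F :: "nat \<Rightarrow> 'a set" and z where F: "F 1 = ?K"
      "\<forall>i\<in>{1..k}. z i \<in> dual_cone (F i) \<inter> L\<^sup>\<bottom> \<inter> {a}\<^sup>\<bottom> \<and> F (i + 1) = F i \<inter> {z i}\<^sup>\<bottom>"
      "PPS (F (k + 1)) L a"
      by (elim exE conjE)
    \<comment> \<open>\<open>K\<close> and \<open>w\<close> are prepended at index 1, and the chain
      of the smaller cone moves up by one.\<close>
    define F' where "F' i = (if i = 1 then K else F (i - 1))" for i
    define z' where "z' i = (if i = 1 then w else z (i - 1))" for i :: nat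
    have "z' i \<in> dual_cone (F' i) \<inter> L\<^sup>\<bottom> \<inter> {a}\<^sup>\<bottom> \<and> F' (i + 1) = F' i \<inter> {z' i}\<^sup>\<bottom>"
      if i: "i \<in> {1..Suc k}" for i
    proof (cases "i = 1")
      case True
      then show ?thesis using w(1) F(1) by (simp add: F'_def z'_def)
    next
      case False
      then obtain j where j: "i = j + 1" "j \<in> {1..k}" using i by (cases i) auto
      then show ?thesis using bspec[OF F(2) j(2)] by (simp add: F'_def z'_def)
    qed
    moreover have "PPS (F' (Suc k + 1)) L a" using F(3) by (simp add: F'_def)
    ultimately show ?thesis
      by (intro exI[of _ "Suc k"] exI[of _ F'] exI[of _ z']) (simp add: F'_def)
  qed
qed

section \<open>Composing the facial residuals\<close>

text \<open>The index 0 is split off because \<open>0 powr 0 = 0\<close>.\<close>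

definition residual_sum :: "nat \<Rightarrow> real \<Rightarrow> real \<Rightarrow> real" where
  "residual_sum k \<epsilon> n = \<epsilon> + (\<Sum>j = 1..k. \<epsilon> powr (1 / 2 ^ j) * n powr (1 - 1 / 2 ^ j))"

lemma residual_sum_ge: "\<epsilon> \<le> residual_sum k \<epsilon> n"
  by (simp add: residual_sum_def sum_nonneg)

lemma residual_sum_mono: "residual_sum k \<epsilon> n \<le> residual_sum (Suc k) \<epsilon> n"
  by (simp add: residual_sum_def)

lemma sqrt_sum_le:
  fixes f :: "'i \<Rightarrow> real"
  assumes "\<And>i. i \<in> I \<Longrightarrow> 0 \<le> f i"
  shows "sqrt (\<Sum>i\<in>I. f i) \<le> (\<Sum>i\<in>I. sqrt (f i))"
  using assms
proof (induction I rule: infinite_finite_induct)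
  case (insert i I)
  then have "sqrt (f i + (\<Sum>i\<in>I. f i)) \<le> sqrt (f i) + sqrt (\<Sum>i\<in>I. f i)"
    by (intro sqrt_add_le_add_sqrt sum_nonneg) auto
  then show ?case using insert by force
qed auto

text \<open>The geometric mean with \<open>n\<close> halves the exponent of
  \<open>\<epsilon>\<close>, so by subadditivity of the square root the sum shifts by one index; the
  term \<open>\<epsilon>\<close> becomes the one at \<open>j = 1\<close>.\<close>

lemma sqrt_residual_sum:
  assumes "0 \<le> \<epsilon>" "0 \<le> n"
  shows "sqrt (residual_sum k \<epsilon> n * n) \<le> residual_sum (Suc k) \<epsilon> n"
proof -
  define g where "g j = \<epsilon> powr (1 / 2 ^ j) * n powr (1 - 1 / 2 ^ j)" for j :: nat
  have step: "sqrt (\<epsilon> powr p * n powr (1 - p) * n) = \<epsilon> powr (p / 2) * n powr (1 - p / 2)" for p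
  proof (cases "n = 0")
    case False
    then have "n powr (1 - p) * n = n powr (2 - p)"
      using assms(2) powr_mult_base[of n "1 - p"] by (simp add: mult.commute)
    then have "sqrt (\<epsilon> powr p * n powr (1 - p) * n) = sqrt (\<epsilon> powr p) * sqrt (n powr (2 - p))"
      by (simp add: mult.assoc real_sqrt_mult)
    also have "\<dots> = \<epsilon> powr (p / 2) * n powr ((2 - p) / 2)"
      by (simp add: powr_half_sqrt[symmetric] powr_powr)
    also have "(2 - p) / 2 = 1 - p / 2" by simp
    finally show ?thesis .
  qed simp
  have gSuc: "sqrt (g j * n) = g (Suc j)" for j
    using step[of "1 / 2 ^ j"] by (simp add: g_def mult.commute)
  have g1: "sqrt (\<epsilon> * n) = g 1"
    using step[of 1] assms by (cases "n = 0") (simp_all add: g_def)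
  have "sqrt (residual_sum k \<epsilon> n * n) = sqrt (\<epsilon> * n + (\<Sum>j = 1..k. g j * n))"
    by (simp add: residual_sum_def g_def distrib_right sum_distrib_right)
  also have "\<dots> \<le> sqrt (\<epsilon> * n) + sqrt (\<Sum>j = 1..k. g j * n)"
    using assms by (intro sqrt_add_le_add_sqrt sum_nonneg) (auto simp: g_def)
  also have "\<dots> \<le> g 1 + (\<Sum>j = 1..k. g (Suc j))"
    using sqrt_sum_le[of "{1..k}" "\<lambda>j. g j * n"] assms by (simp add: g1 gSuc) (simp add: g_def)
  also have "\<dots> = (\<Sum>j = 1..Suc k. g j)"
    using sum.atLeast_Suc_atMost[of 1 "Suc k" g] sum.shift_bounds_cl_Suc_ivl[of g 1 k] by simp
  also have "\<dots> \<le> residual_sum (Suc k) \<epsilon> n"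
    using assms by (simp add: residual_sum_def g_def)
  finally show ?thesis .
qed

text \<open>Each face remains the cone of squares of a subalgebra, so the one-step residual can be
  iterated. The pairing of \<open>x\<close> with \<open>z (k + 1)\<close> is small because that
  vector vanishes on \<open>affine_translate L a\<close>.\<close>

lemma (in euclidean_jordan_algebra) facial_chain_error_bound:
  fixes F :: "nat \<Rightarrow> 'a set" and L :: "'a set"
  assumes L: "subspace L" and F1: "F 1 = cone_of_squares jp"
    and chain: "\<forall>i\<in>{1..k}. z i \<in> dual_cone (F i) \<inter> L\<^sup>\<bottom> \<inter> {a}\<^sup>\<bottom> \<and> F (i + 1) = F i \<inter> {z i}\<^sup>\<bottom>"
  shows "\<exists>W u \<kappa>. jordan_subalgebra jp e W u \<and> F (k + 1) = squares_of jp W \<and> \<kappa> > 0 \<and>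
    (\<forall>x \<epsilon>. infdist x (cone_of_squares jp) \<le> \<epsilon> \<longrightarrow> infdist x (affine_translate L a) \<le> \<epsilon> \<longrightarrow>
       infdist x (F (k + 1)) \<le> \<kappa> * residual_sum k \<epsilon> (norm x))"
  using chain
proof (induction k)
  case 0
  have "jordan_subalgebra jp e UNIV e" by unfold_locales (auto simp: jp_unit)
  moreover have "F 1 = squares_of jp UNIV" using F1 by (simp add: cone_of_squares_def squares_of_def)
  ultimately show ?case
    using F1 by (intro exI[of _ UNIV] exI[of _ e] exI[of _ 1]) (simp add: residual_sum_def)
next
  case (Suc k)
  let ?M = "affine_translate L a"
  have chain: "\<forall>i\<in>{1..k}. z i \<in> dual_cone (F i) \<inter> L\<^sup>\<bottom> \<inter> {a}\<^sup>\<bottom> \<and> F (i + 1) = F i \<inter> {z i}\<^sup>\<bottom>"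
    using Suc.prems by simp
  obtain W u \<kappa> where W: "jordan_subalgebra jp e W u" "F (k + 1) = squares_of jp W" and \<kappa>: "\<kappa> > 0"
    and IH: "\<And>x \<epsilon>. infdist x (cone_of_squares jp) \<le> \<epsilon> \<Longrightarrow> infdist x ?M \<le> \<epsilon> \<Longrightarrow>
       infdist x (F (k + 1)) \<le> \<kappa> * residual_sum k \<epsilon> (norm x)"
    using Suc.IH[OF chain] by blast
  interpret W: jordan_subalgebra jp e W u by fact
  let ?z = "z (k + 1)"
  have z: "?z \<in> dual_cone (squares_of jp W)" "?z \<in> L\<^sup>\<bottom>" "?z \<in> {a}\<^sup>\<bottom>"
    and F: "F (Suc k + 1) = squares_of jp W \<inter> {?z}\<^sup>\<bottom>"
    using bspec[OF Suc.prems, of "k + 1"] unfolding W(2)[symmetric] by simp_all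
  obtain W' u' \<rho> where W': "jordan_subalgebra jp e W' u'" "squares_of jp W \<inter> {?z}\<^sup>\<bottom> = squares_of jp W'"
    and \<rho>: "\<rho> > 0"
    and res: "\<And>x \<delta>. infdist x (squares_of jp W) \<le> \<delta> \<Longrightarrow> x \<bullet> ?z \<le> \<delta> \<Longrightarrow>
       infdist x (squares_of jp W') \<le> \<rho> * (\<delta> + sqrt (\<delta> * norm x))"
    by (rule W.facial_residual[OF z(1)]) (rule that)
  \<comment> \<open>\<open>\<theta> * ?S\<close> has to dominate both the distance to the previous
    face and the pairing with \<open>?z\<close>.\<close>
  define \<theta> where "\<theta> = \<kappa> + norm ?z"
  have \<theta>: "\<theta> > 0" using \<kappa> by (simp add: \<theta>_def add_pos_nonneg)
  have M: "closed ?M" "?M \<noteq> {}"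
    using affine_closed[OF affine_translate_affine[OF L]] subspace_0[OF L]
    by (auto simp: affine_translate_def)
  have bound: "infdist x (F (Suc k + 1)) \<le> (\<rho> * (\<theta> + sqrt \<theta>)) * residual_sum (Suc k) \<epsilon> (norm x)"
    if d: "infdist x (cone_of_squares jp) \<le> \<epsilon>" "infdist x ?M \<le> \<epsilon>" for x \<epsilon>
  proof -
    let ?S = "residual_sum k \<epsilon> (norm x)" and ?S' = "residual_sum (Suc k) \<epsilon> (norm x)"
    have \<epsilon>: "0 \<le> \<epsilon>" using d(1) infdist_nonneg order_trans by blast
    have S: "0 \<le> ?S" "\<epsilon> \<le> ?S" using residual_sum_ge[of \<epsilon> k "norm x"] \<epsilon> by auto
    obtain m where m: "m \<in> ?M" "infdist x ?M = dist x m"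
      by (rule infdist_attains_inf[OF M]) (rule that)
    have "m \<bullet> ?z = 0"
      using m(1) z(2,3) by (auto simp: affine_translate_def orthogonal_comp_def orthogonal_def inner_simps)
    then have "x \<bullet> ?z = (x - m) \<bullet> ?z" by (simp add: inner_diff_left)
    also have "\<dots> \<le> norm (x - m) * norm ?z" by (rule norm_cauchy_schwarz)
    also have "\<dots> \<le> ?S * norm ?z"
      using d(2) m(2) S by (intro mult_right_mono) (auto simp: dist_norm)
    also have "\<dots> \<le> \<theta> * ?S" using \<kappa> S by (simp add: \<theta>_def algebra_simps)
    finally have xz: "x \<bullet> ?z \<le> \<theta> * ?S" .
    have "\<kappa> * ?S \<le> \<theta> * ?S" using S by (intro mult_right_mono) (simp_all add: \<theta>_def)
    then have "infdist x (squares_of jp W) \<le> \<theta> * ?S" using IH[OF d] W(2) by simp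
    then have "infdist x (F (Suc k + 1)) \<le> \<rho> * (\<theta> * ?S + sqrt (\<theta> * ?S * norm x))"
      using res[OF _ xz] F W'(2) by simp
    also have "sqrt (\<theta> * ?S * norm x) = sqrt \<theta> * sqrt (?S * norm x)"
      by (simp add: real_sqrt_mult mult.assoc)
    also have "\<rho> * (\<theta> * ?S + sqrt \<theta> * sqrt (?S * norm x)) \<le> \<rho> * (\<theta> * ?S' + sqrt \<theta> * ?S')"
      using \<rho> \<theta> \<epsilon> by (intro mult_left_mono add_mono residual_sum_mono sqrt_residual_sum) auto
    finally show ?thesis by (simp add: algebra_simps)
  qed
  have "\<rho> * (\<theta> + sqrt \<theta>) > 0" using \<rho> \<theta> by (simp add: add_pos_pos)
  then show ?case using W' F bound
    by (intro exI[of _ W'] exI[of _ u'] exI[of _ "\<rho> * (\<theta> + sqrt \<theta>)"]) (simp only: simp_thms, blast)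
qed

section \<open>Assembly of the error bound from a shortest chain and the PPS bound on its last
  face\<close>

theorem theorem37:
  fixes jp :: "'a::euclidean_space \<Rightarrow> 'a \<Rightarrow> 'a" and e :: 'a
    and K L :: "'a set" and a :: 'a
  assumes "euclidean_jordan_algebra jp e"
    and "\<And>x y. x \<bullet> y = jordan_trace jp e (jp x y)"
    and "K = cone_of_squares jp"
    and "subspace L"
    and "K \<inter> affine_translate L a \<noteq> {}"
  shows "\<exists>\<kappa>>0. \<forall>x \<epsilon>.
           infdist x K \<le> \<epsilon> \<longrightarrow> infdist x (affine_translate L a) \<le> \<epsilon> \<longrightarrow>
           infdist x (affine_translate L a \<inter> K)
             \<le> (\<kappa> * norm x + \<kappa>) *
               (\<epsilon> + (\<Sum>j = 1..d_PPS K L a.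
                  \<epsilon> powr (1 / 2 ^ j) * norm x powr (1 - 1 / 2 ^ j)))"
proof -
  interpret euclidean_jordan_algebra jp e by fact
  let ?M = "affine_translate L a"
  interpret E: jordan_subalgebra jp e UNIV e by unfold_locales (auto simp: jp_unit)
  have K: "K = squares_of jp UNIV" using assms(3) by (simp add: cone_of_squares_def squares_of_def)
  define d where "d = d_PPS K L a"
  have "closed K" "convex_cone K"
    unfolding K by (rule E.squares_closed, rule E.squares_convex_cone)
  note reduction = facial_reduction_terminates[OF this assms(4,5)]
  define Q where "Q k \<longleftrightarrow> (\<exists>(F :: nat \<Rightarrow> 'a set) z. F 1 = K \<and>
    (\<forall>i\<in>{1..k}. z i \<in> dual_cone (F i) \<inter> L\<^sup>\<bottom> \<inter> {a}\<^sup>\<bottom> \<and> F (i + 1) = F i \<inter> {z i}\<^sup>\<bottom>) \<and>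
    PPS (F (k + 1)) L a)" for k
  have "\<exists>k. Q k" using reduction unfolding Q_def .
  then have "Q (LEAST k. Q k)" by (rule LeastI_ex)
  then have "Q d" unfolding d_def d_PPS_def Q_def .
  then obtain F z where F1: "F 1 = K"
    and chain: "\<forall>i\<in>{1..d}. z i \<in> dual_cone (F i) \<inter> L\<^sup>\<bottom> \<inter> {a}\<^sup>\<bottom> \<and> F (i + 1) = F i \<inter> {z i}\<^sup>\<bottom>"
    and PPS: "PPS (F (d + 1)) L a"
    unfolding Q_def by (elim exE conjE)
  have F1': "F 1 = cone_of_squares jp" using F1 assms(3) by simp
  from facial_chain_error_bound[OF assms(4) F1' chain]
  obtain \<rho> where \<rho>0: "\<rho> > 0"
    and \<rho>: "\<forall>x \<epsilon>. infdist x K \<le> \<epsilon> \<longrightarrow> infdist x ?M \<le> \<epsilon> \<longrightarrow>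
       infdist x (F (d + 1)) \<le> \<rho> * residual_sum d \<epsilon> (norm x)"
    unfolding assms(3)[symmetric] by (elim exE conjE)
  obtain \<sigma> where \<sigma>: "\<sigma> > 0" "\<And>x \<epsilon>. infdist x (F (d + 1)) \<le> \<epsilon> \<Longrightarrow> infdist x ?M \<le> \<epsilon> \<Longrightarrow>
       infdist x (?M \<inter> F (d + 1)) \<le> (\<sigma> * norm x + \<sigma>) * \<epsilon>"
    by (rule PPS_error_bound[OF assms(4) PPS]) (rule that)
  have "F (i + 1) \<subseteq> K" if "i \<le> d" for i
    using that
  proof (induction i)
    case (Suc i)
    then have "F (Suc i + 1) = F (i + 1) \<inter> {z (i + 1)}\<^sup>\<bottom>" using chain by auto
    then show ?case using Suc by auto
  qed (use F1 in simp)
  then have FK: "F (d + 1) \<subseteq> K" by blast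
  \<comment> \<open>\<open>infdist\<close> to the empty set is 0, so monotonicity in the set
    requires this.\<close>
  have ne: "?M \<inter> F (d + 1) \<noteq> {}"
  proof -
    obtain E1 C1 C2 x1 x2 where "F (d + 1) = C1 + C2" "x1 \<in> rel_interior C1" "x2 \<in> C2" "x1 + x2 \<in> ?M"
      using PPS unfolding PPS_def by blast
    then show ?thesis using rel_interior_subset by blast
  qed
  \<comment> \<open>The factor \<open>1 + \<rho>\<close> covers the distances to both the last face
    and \<open>?M\<close>, so that \<open>\<sigma>\<close> applies at one common level.\<close>
  define \<kappa> where "\<kappa> = \<sigma> * (1 + \<rho>)"
  have "infdist x (?M \<inter> K) \<le> (\<kappa> * norm x + \<kappa>) * residual_sum d \<epsilon> (norm x)"
    if dx: "infdist x K \<le> \<epsilon>" "infdist x ?M \<le> \<epsilon>" for x \<epsilon>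
  proof -
    let ?S = "residual_sum d \<epsilon> (norm x)"
    have S: "0 \<le> \<epsilon>" "\<epsilon> \<le> ?S" using dx(1) infdist_nonneg order_trans residual_sum_ge by blast+
    then have "?S \<le> (1 + \<rho>) * ?S" "\<rho> * ?S \<le> (1 + \<rho>) * ?S" using \<rho>0 by (simp_all add: algebra_simps)
    then have "infdist x (?M \<inter> F (d + 1)) \<le> (\<sigma> * norm x + \<sigma>) * ((1 + \<rho>) * ?S)"
      using dx(2) \<rho>[rule_format, OF dx] S by (intro \<sigma>(2)) linarith+
    moreover have "infdist x (?M \<inter> K) \<le> infdist x (?M \<inter> F (d + 1))"
      using FK by (intro infdist_mono ne) blast
    ultimately show ?thesis by (simp add: \<kappa>_def algebra_simps)
  qed
  moreover have "\<kappa> > 0" using \<sigma>(1) \<rho>0 by (simp add: \<kappa>_def)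
  ultimately show ?thesis unfolding residual_sum_def d_def by blast
qed

end
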